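(* Let $0<q<1$. For each of the six choices of $\left(\tau^{\alpha\beta}_{2n}(q),\ \mathrm{TAB},\ M,\ I,\ 1/(C,D)\right)$ listed below, and every integer $n\ge 0$, we have \[ f_{2n}:=\frac{\tau_{2n}^{\alpha\beta}(q)}{(1-q)^{2n}}=\sum_{\pi\in \mathrm{TAB}}q^{|\pi|} = \frac{M}{(q;q)_{2n}} = \frac{I}{(q;q)_{2n}} , \] and, as power series in $x$, \[ \sum_{n\ge0} f_{2n} x^{2n} = \frac{1}{\sum_{n\ge0}(-1)^nq^{Cn^2+Dn}x^{2n}/(q;q)_{2n}}. \] In the list, $\pi_*$ may be taken to be either $\pi_o$ (for all $\pi$) or $\pi_e$ (for all $\pi$); the assertion holds for both choices. (1) $\tau^{\ge<}_{2n}(q)$; $\mathrm{TAB}=\mathrm{SSYT}(\delta^{(0,1)}_{n+2}/\delta_n)$; $M=\sum_{\pi\in\mathrm{Alt}_{2n}}q^{\mathrm{maj}(\pi^{-1})}$; $I=\sum_{\pi\in\mathrm{Alt}_{2n}}q^{\mathrm{inv}(\pi)}$; $(C,D)=(0,0)$. (2) $\tau^{\ge\le}_{2n}(q)$; $\mathrm{TAB}=\mathrm{RPP}(\delta^{(0,1)}_{n+2}/\delta_n)$; $M=\sum_{\pi\in\mathrm{Alt}_{2n}}q^{\mathrm{maj}(\kappa_{2n}\pi^{-1})}$; $I=\sum_{\pi\in\mathrm{Alt}_{2n}}q^{\mathrm{inv}(\pi)-\mathrm{asc}(\pi_* )}$; $(C,D)=(1,-1)$. (3) $\tau^{><}_{2n}(q)$;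 $\mathrm{TAB}=\mathrm{ST}(\delta^{(0,1)}_{n+2}/\delta_n)$; $M=\sum_{\pi\in\mathrm{Alt}_{2n}}q^{\mathrm{maj}(\eta_{2n}\pi^{-1})}$; $I=\sum_{\pi\in\mathrm{Alt}_{2n}}q^{\mathrm{inv}(\pi)+\mathrm{nasc}(\pi_* )}$; $(C,D)=(1,0)$. (4) $\tau^{<\ge}_{2n}(q)$; $\mathrm{TAB}=\mathrm{SSYT}(\delta^{(1,0)}_{n+2}/\delta_n)$; $M=\sum_{\pi\in\mathrm{Ralt}_{2n}}q^{\mathrm{maj}(\pi^{-1})}$; $I=\sum_{\pi\in\mathrm{Ralt}_{2n}}q^{\mathrm{inv}(\pi)}$; $(C,D)=(2,-1)$. (5) $\tau^{\le\ge}_{2n}(q)$; $\mathrm{TAB}=\mathrm{RPP}(\delta^{(1,0)}_{n+2}/\delta_n)$; $M=\sum_{\pi\in\mathrm{Ralt}_{2n}}q^{\mathrm{maj}(\eta_{2n}\pi^{-1})}$; $I=\sum_{\pi\in\mathrm{Ralt}_{2n}}q^{\mathrm{inv}(\pi)-\mathrm{ndes}(\pi_* )}$; $(C,D)=(1,-1)$. (6) $\tau^{<>}_{2n}(q)$; $\mathrm{TAB}=\mathrm{ST}(\delta^{(1,0)}_{n+2}/\delta_n)$; $M=\sum_{\pi\in\mathrm{Ralt}_{2n}}q^{\mathrm{maj}(\kappa_{2n}\pi^{-1})}$; $I=\sum_{\pi\in\mathrm{Ralt}_{2n}}q^{\mathrm{inv}(\pi)+\mathrm{des}(\pi_* )}$;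 $(C,D)=(1,0)$.
   Context: $(a;q)_m=(1-a)(1-aq)\cdots(1-aq^{m-1})$. For inequality symbols $\alpha,\beta$, $\tau_m^{\alpha\beta}(q)$ is the probability that a random word $w_1\cdots w_m$ of positive integers, whose letters are chosen independently with $\Pr(w_i=k)=q^{k-1}(1-q)$ for $k\ge1$, satisfies $w_1\,\alpha\, w_2\,\beta\, w_3\,\alpha\, w_4\,\beta\cdots$ (alternating relations). Shapes: $\delta_m=(m-1,m-2,\dots,1)$ (with $\delta_0=\delta_1=\emptyset$), and $\delta_m^{(0,1)}=(m-1,m-2,\dots,2)$, $\delta_m^{(1,0)}=(m-2,m-2,m-3,\dots,1)$ for $m\ge3$, while $\delta_2^{(0,1)}=\delta_2^{(1,0)}=\emptyset$. For partitions $\mu\subset\lambda$, $\lambda/\mu$ is the set difference of Young diagrams. Fillings of $\lambda/\mu$ are by nonnegative integers: $\mathrm{SSYT}(\lambda/\mu)$: weakly increasing in rows and strictly increasing in columns; $\mathrm{RPP}(\lambda/\mu)$: weakly increasing in rows and columns; $\mathrm{ST}(\lambda/\mu)$: strictly increasing in rows and columns. $|\pi|$ is the sum of the entries of a filling. Permutations: $\mathfrak S_m$ is the set of permutations of $\{1,\dots,m\}$, also written as words $\pi_1\cdots\pi_m$, $\pi_i=\pi(i)$, with product $\pi\sigma(i)=\pi(\sigma(i))$. $\mathrm{Alt}_m$: those with $\pi_1<\pi_2>\pi_3<\cdots$; $\mathrm{Ralt}_m$: those with $\pi_1>\pi_2<\pi_3>\cdots$. $\pi_o=\pi_1\pi_3\pi_5\cdots$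 (odd positions), $\pi_e=\pi_2\pi_4\pi_6\cdots$ (even positions), as words. $\eta_{2n}=(1,2)(3,4)\cdots(2n-1,2n)$ and $\kappa_{2n}=(1)(2,3)(4,5)\cdots(2n-2,2n-1)(2n)$ in cycle notation. For a word $w=w_1\cdots w_m$ of integers: $\mathrm{des}(w)$ (resp. $\mathrm{asc}(w)$) is the number of $i\in\{1,\dots,m-1\}$ with $w_i>w_{i+1}$ (resp. $w_i<w_{i+1}$); $\mathrm{ndes}(w)=m-\mathrm{des}(w)$ and $\mathrm{nasc}(w)=m-\mathrm{asc}(w)$; $\mathrm{maj}(w)$ is the sum of the $i\in\{1,\dots,m-1\}$ with $w_i>w_{i+1}$; $\mathrm{inv}(w)$ is the number of pairs $i<j$ with $w_i>w_j$. For $n=0$ the only permutation is the empty word, with all statistics equal to $0$. *)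

theory Defs
  imports
    "HOL-Probability.Probability"
    "HOL-Combinatorics.Permutations"
    "HOL-Computational_Algebra.Formal_Power_Series"
begin

definition qpochhammer :: "real \<Rightarrow> real \<Rightarrow> nat \<Rightarrow> real" where
  "qpochhammer a q m = (\<Prod>k<m. 1 - a * q ^ k)"

text \<open>Words are lists.  List positions start at 0, so the relation between the letters
  \<open>w\<^sub>1\<close> and \<open>w\<^sub>2\<close> is the one at list index 0.\<close>

definition alternating :: "(nat \<Rightarrow> nat \<Rightarrow> bool) \<Rightarrow> (nat \<Rightarrow> nat \<Rightarrow> bool) \<Rightarrow> nat list \<Rightarrow> bool" where
  "alternating \<alpha> \<beta> w \<longleftrightarrow>
     (\<forall>i. Suc i < length w \<longrightarrow> (if even i then \<alpha> else \<beta>) (w ! i) (w ! Suc i))"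

text \<open>\<^const>\<open>geometric_pmf\<close> is supported on \<open>{0, 1, \<dots>}\<close>; the shift by \<^const>\<open>Suc\<close> gives
  the letter \<open>k \<ge> 1\<close> the probability \<open>q ^ (k - 1) * (1 - q)\<close>.\<close>

definition letter_pmf :: "real \<Rightarrow> nat pmf" where
  "letter_pmf q = map_pmf Suc (geometric_pmf (1 - q))"

definition tau :: "(nat \<Rightarrow> nat \<Rightarrow> bool) \<Rightarrow> (nat \<Rightarrow> nat \<Rightarrow> bool) \<Rightarrow> nat \<Rightarrow> real \<Rightarrow> real" where
  "tau \<alpha> \<beta> m q = measure_pmf.prob (replicate_pmf m (letter_pmf q)) {w. alternating \<alpha> \<beta> w}"

text \<open>A partition is the list of its parts; the cell \<open>(i, j)\<close> of a diagram lies in row \<open>i\<close>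
  and column \<open>j\<close>, both counted from 0.\<close>

definition diagram :: "nat list \<Rightarrow> (nat \<times> nat) set" where
  "diagram p = {(i, j). i < length p \<and> j < p ! i}"

definition skew :: "nat list \<Rightarrow> nat list \<Rightarrow> (nat \<times> nat) set" where
  "skew l m = diagram l - diagram m"

definition delta :: "nat \<Rightarrow> nat list" where
  "delta m = rev [1..<m]"

text \<open>The next two shapes are only meaningful for \<open>m \<ge> 2\<close>.\<close>

definition delta01 :: "nat \<Rightarrow> nat list" where
  "delta01 m = (if m \<le> 2 then [] else rev [2..<m])"

definition delta10 :: "nat \<Rightarrow> nat list" where
  "delta10 m = (if m \<le> 2 then [] else (m - 2) # rev [1..<m - 1])"

text \<open>Fillings of a set \<open>D\<close> of cells, with relation \<open>R\<close> along rows and \<open>K\<close> down columns, are functions with domain \<open>D\<close>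
  (extensional, so that each filling is represented by exactly one function).\<close>

definition fillings ::
    "(nat \<Rightarrow> nat \<Rightarrow> bool) \<Rightarrow> (nat \<Rightarrow> nat \<Rightarrow> bool) \<Rightarrow> (nat \<times> nat) set \<Rightarrow> (nat \<times> nat \<Rightarrow> nat) set" where
  "fillings R K D =
     {T \<in> D \<rightarrow>\<^sub>E UNIV.
        (\<forall>i j j'. (i, j) \<in> D \<longrightarrow> (i, j') \<in> D \<longrightarrow> j < j' \<longrightarrow> R (T (i, j)) (T (i, j'))) \<and>
        (\<forall>i i' j. (i, j) \<in> D \<longrightarrow> (i', j) \<in> D \<longrightarrow> i < i' \<longrightarrow> K (T (i, j)) (T (i', j)))}"

definition SSYT :: "(nat \<times> nat) set \<Rightarrow> (nat \<times> nat \<Rightarrow> nat) set" where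
  "SSYT = fillings (\<le>) (<)"

definition RPP :: "(nat \<times> nat) set \<Rightarrow> (nat \<times> nat \<Rightarrow> nat) set" where
  "RPP = fillings (\<le>) (\<le>)"

definition ST :: "(nat \<times> nat) set \<Rightarrow> (nat \<times> nat \<Rightarrow> nat) set" where
  "ST = fillings (<) (<)"

definition perm_word :: "nat \<Rightarrow> (nat \<Rightarrow> nat) \<Rightarrow> nat list" where
  "perm_word m p = map p [1..<Suc m]"

definition Alt :: "nat \<Rightarrow> (nat \<Rightarrow> nat) set" where
  "Alt m = {p. p permutes {1..m} \<and> alternating (<) (>) (perm_word m p)}"

definition Ralt :: "nat \<Rightarrow> (nat \<Rightarrow> nat) set" where
  "Ralt m = {p. p permutes {1..m} \<and> alternating (>) (<) (perm_word m p)}"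

text \<open>List index \<open>i\<close> is position \<open>i + 1\<close>, so the odd positions are the even list indices.\<close>

definition odd_part :: "nat list \<Rightarrow> nat list" where
  "odd_part w = nths w {i. even i}"

definition even_part :: "nat list \<Rightarrow> nat list" where
  "even_part w = nths w {i. odd i}"

text \<open>\<open>eta n\<close> and \<open>kappa n\<close> are the permutations \<open>\<eta>\<close> and \<open>\<kappa>\<close> of \<open>{1..2 * n}\<close>,
  written as products of their disjoint 2-cycles.\<close>

definition eta :: "nat \<Rightarrow> nat \<Rightarrow> nat" where
  "eta n = foldr (\<circ>) (map (\<lambda>k. Transposition.transpose (2 * k - 1) (2 * k)) [1..<Suc n]) id"

definition kappa :: "nat \<Rightarrow> nat \<Rightarrow> nat" where
  "kappa n = foldr (\<circ>) (map (\<lambda>k. Transposition.transpose (2 * k) (2 * k + 1)) [1..<n]) id"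

text \<open>Positions in these statistics are counted from 1: \<open>w\<^sub>i\<close> is \<open>w ! (i - 1)\<close>.\<close>

definition des :: "nat list \<Rightarrow> nat" where
  "des w = card {i \<in> {1..<length w}. w ! (i - 1) > w ! i}"

definition asc :: "nat list \<Rightarrow> nat" where
  "asc w = card {i \<in> {1..<length w}. w ! (i - 1) < w ! i}"

definition ndes :: "nat list \<Rightarrow> nat" where
  "ndes w = length w - des w"

definition nasc :: "nat list \<Rightarrow> nat" where
  "nasc w = length w - asc w"

definition maj :: "nat list \<Rightarrow> nat" where
  "maj w = \<Sum>{i \<in> {1..<length w}. w ! (i - 1) > w ! i}"

definition inv_num :: "nat list \<Rightarrow> nat" where
  "inv_num w = card {(i, j). i < j \<and> j < length w \<and> w ! i > w ! j}"

text \<open>\<open>M\<close>: the sum over \<open>\<pi> \<in> P (2 * n)\<close> of \<open>q\<close> to the power of the major index of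
  \<open>\<sigma> n \<circ> \<pi>\<inverse>\<close>.\<close>

definition maj_sum :: "real \<Rightarrow> (nat \<Rightarrow> (nat \<Rightarrow> nat) set) \<Rightarrow> (nat \<Rightarrow> nat \<Rightarrow> nat) \<Rightarrow> nat \<Rightarrow> real" where
  "maj_sum q P \<sigma> n = (\<Sum>\<pi>\<in>P (2 * n). q ^ maj (perm_word (2 * n) (\<sigma> n \<circ> inv \<pi>)))"

text \<open>\<open>I\<close>: the correction \<open>stat\<close> to the number of inversions is an integer depending on the
  word of \<open>\<pi>\<close>; the exponents are integers to avoid truncated subtraction.\<close>

definition inv_sum :: "real \<Rightarrow> (nat \<Rightarrow> (nat \<Rightarrow> nat) set) \<Rightarrow> (nat list \<Rightarrow> int) \<Rightarrow> nat \<Rightarrow> real" where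
  "inv_sum q P stat n =
     (\<Sum>\<pi>\<in>P (2 * n). q powi (int (inv_num (perm_word (2 * n) \<pi>)) + stat (perm_word (2 * n) \<pi>)))"

text \<open>The formal power series \<open>\<Sum>n. a n * x ^ (2 * n)\<close>.\<close>

definition even_fps :: "(nat \<Rightarrow> real) \<Rightarrow> real fps" where
  "even_fps a = Abs_fps (\<lambda>k. if even k then a (k div 2) else 0)"

end

theory Submission
  imports Defs "HOL-Combinatorics.Multiset_Permutations"
begin

text \<open>All quantities in the theorem are compared with one of them: the sum, over the words
  \<open>w\<close> of length \<open>2n\<close> in the letters \<open>0, 1, \<dots>\<close> that satisfy
  \<open>w\<^sub>1 \<alpha> w\<^sub>2 \<beta> w\<^sub>3 \<alpha> \<dots>\<close>, of \<open>q\<close> to the power of the sum of the letters.  The probability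
  differs from it by the factor \<open>(1 - q)\<^sup>2\<^sup>n\<close> because every letter contributes one factor
  \<open>1 - q\<close> (\<open>tau_eq_word_weight\<close>).  The fillings are these words written along a
  zigzag: each skew shape is a ribbon whose consecutive cells lie alternately in a common row and
  in a common column (\<open>fillings_delta01\<close>, \<open>fillings_delta10\<close>).

  The generating function comes from inclusion and exclusion.  A word whose relations are \<open>\<alpha>, \<not>\<beta>, \<alpha>, \<not>\<beta>, \<dots>\<close> is
  a monotone chain in which some steps must be strict, so the sum over such words is a power of \<open>q\<close>
  divided by \<open>(q;q)\<^sub>2\<^sub>k\<close> (\<open>chains_weight\<close>).  Placing such a chain in front of an
  alternating word leaves one link free; that link satisfies either \<open>\<beta>\<close> or its negation, and the
  alternating sum over \<open>k\<close> telescopes (\<open>alt_words_weight_convolution\<close>).  This says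
  that the series of the words is the reciprocal of the series of the chains.

  For the major index, sort the positions of a word by decreasing letter, breaking ties
  by a fixed labelling \<open>\<omega>\<close> of the positions.  The words sorted by one given permutation are
  chains whose strict steps sit at the descents of a word of labels, and the position \<open>i\<close> of a
  strict step costs \<open>q\<^sup>i\<close>; hence the exponent is a major index (\<open>ranks_weight\<close>).
  With \<open>\<omega>\<close> the identity, \<open>\<kappa>\<close> or \<open>\<eta>\<close>, the
  tie-breaking turns the relations \<open>\<alpha>, \<beta>\<close> on letters into rises and falls of the
  permutation.

  For the inversion sums the generating function is computed afresh.  Cutting an
  alternating permutation at its maximum gives two shorter alternating permutations, and the
  inversions between them produce a \<open>q\<close>-binomial coefficient (\<open>sum_power_cross\<close>).
  The ascent statistic changes in a controlled way, since the maximum stands in an even position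
  and so separates the two halves of the subword of even positions.  The resulting quadratic
  recurrence is the coefficient form of a \<open>q\<close>-difference equation, which is solved by a
  \<open>q\<close>-secant plus a \<open>q\<close>-tangent: \<open>1/C + S/C\<close> with explicit series \<open>C\<close>, \<open>S\<close>
  (\<open>secant_tangent_recurrence\<close>).  Only the weights \<open>q ^ inv\<close> and
  \<open>q ^ (inv - asc)\<close> on \<open>Alt\<close> are treated in this way.  The reverse complement exchanges odd and even
  positions, the complement exchanges \<open>Alt\<close> and \<open>Ralt\<close> at the price of replacing
  \<open>q\<close> by \<open>1/q\<close>, and the remaining weights differ by a factor \<open>q\<^sup>n\<close>.  Because of
  the substitution \<open>1/q\<close> the finite results on inversions cover every positive \<open>q \<noteq> 1\<close>.\<close>

unbundle no vec_syntax and fps_syntax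

section \<open>Weights of sets of words\<close>

lemma has_sum_times_nonneg:
  fixes f :: "'a \<Rightarrow> real" and g :: "'b \<Rightarrow> real"
  assumes f: "(f has_sum a) A" and g: "(g has_sum b) B"
    and "\<And>x. x \<in> A \<Longrightarrow> 0 \<le> f x" and "\<And>y. y \<in> B \<Longrightarrow> 0 \<le> g y"
  shows "((\<lambda>(x, y). f x * g y) has_sum a * b) (A \<times> B)"
proof (rule has_sum_SigmaI)
  show "((\<lambda>y. case (x, y) of (x, y) \<Rightarrow> f x * g y) has_sum f x * b) B" for x
    using has_sum_cmult_right[OF g, of "f x"] by simp
  show "((\<lambda>x. f x * b) has_sum a * b) A"
    using has_sum_cmult_left[OF f] by simp
  show "(\<lambda>(x, y). f x * g y) summable_on (A \<times> B)"
  proof (rule summable_on_SigmaI)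
    show "((\<lambda>y. case (x, y) of (x, y) \<Rightarrow> f x * g y) has_sum f x * b) B" for x
      using has_sum_cmult_right[OF g, of "f x"] by simp
    show "(\<lambda>x. f x * b) summable_on A"
      using has_sum_cmult_left[OF f] by (auto simp: summable_on_def)
  qed (use assms in auto)
qed

definition word_weight :: "real \<Rightarrow> nat list set \<Rightarrow> real" where
  "word_weight q A = (\<Sum>\<^sub>\<infinity>w\<in>A. q ^ sum_list w)"

lemma has_sum_power_geometric:
  fixes q :: real
  assumes "0 < q" "q < 1" "0 < k"
  shows "((\<lambda>c. q ^ (k * c)) has_sum 1 / (1 - q ^ k)) UNIV"
proof (rule sums_nonneg_imp_has_sum)
  have "q ^ k < 1" using assms by (simp add: power_less_one_iff)
  then show "(\<lambda>c. q ^ (k * c)) sums (1 / (1 - q ^ k))"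
    using geometric_sums[of "q ^ k"] assms by (simp add: power_mult)
qed (use assms in auto)

lemma has_sum_all_words:
  fixes q :: real
  assumes q: "0 < q" "q < 1"
  shows "((\<lambda>w. q ^ sum_list w) has_sum (1 / (1 - q)) ^ m) {w. length w = m}"
proof (induction m)
  case 0
  show ?case by (simp add: has_sum_finiteI)
next
  case (Suc m)
  have "((\<lambda>(c, w). q ^ c * q ^ sum_list w) has_sum (1 / (1 - q)) * (1 / (1 - q)) ^ m)
      (UNIV \<times> {w. length w = m})"
    using has_sum_power_geometric[of q 1] q by (intro has_sum_times_nonneg Suc) auto
  also have "?this \<longleftrightarrow>
      ((\<lambda>w. q ^ sum_list w) has_sum (1 / (1 - q)) * (1 / (1 - q)) ^ m) {w. length w = Suc m}"
    by (rule has_sum_reindex_bij_witness[of _ "\<lambda>w. (hd w, tl w)" "\<lambda>(c, w). c # w"])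
       (auto simp: length_Suc_conv power_add)
  finally show ?case by simp
qed

lemma word_weight_has_sum:
  assumes q: "0 < q" "q < 1" and A: "A \<subseteq> {w. length w = m}"
  shows "((\<lambda>w. q ^ sum_list w) has_sum word_weight q A) A"
  unfolding word_weight_def
  by (rule has_sum_infsum, rule summable_on_subset_banach[OF _ A])
     (use has_sum_all_words[OF q] in \<open>auto simp: summable_on_def\<close>)

lemma word_weight_eqI:
  "((\<lambda>w. q ^ sum_list w) has_sum x) A \<Longrightarrow> word_weight q A = x"
  unfolding word_weight_def by (rule infsumI)

lemma word_weight_Un_disjoint:
  assumes q: "0 < q" "q < 1"
    and "A \<subseteq> {w. length w = m}" "B \<subseteq> {w. length w = m}" "A \<inter> B = {}"
  shows "word_weight q (A \<union> B) = word_weight q A + word_weight q B"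
  using assms by (intro word_weight_eqI has_sum_Un_disjoint word_weight_has_sum) auto

lemma word_weight_UN_disjoint:
  assumes q: "0 < q" "q < 1" and "finite S"
    and "\<And>s. s \<in> S \<Longrightarrow> A s \<subseteq> {w. length w = m}"
    and "\<And>s t. s \<in> S \<Longrightarrow> t \<in> S \<Longrightarrow> s \<noteq> t \<Longrightarrow> A s \<inter> A t = {}"
  shows "word_weight q (\<Union>s\<in>S. A s) = (\<Sum>s\<in>S. word_weight q (A s))"
  using assms(3-)
proof (induction S rule: finite_induct)
  case empty
  then show ?case by (simp add: word_weight_def)
next
  case (insert s S)
  have "word_weight q (A s \<union> (\<Union>t\<in>S. A t)) = word_weight q (A s) + word_weight q (\<Union>t\<in>S. A t)"
    using insert.hyps insert.prems
    by (intro word_weight_Un_disjoint[OF q, of _ m]) (fastforce+)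
  then show ?case using insert by simp
qed

text \<open>A concatenation is described by \<open>take\<close> and \<open>drop\<close> because it is later compared
  with sets given by conditions on neighbouring letters.\<close>

lemma word_weight_append:
  assumes q: "0 < q" "q < 1"
    and A: "A \<subseteq> {w. length w = m}" and B: "B \<subseteq> {w. length w = k}"
  shows "word_weight q {w. length w = m + k \<and> take m w \<in> A \<and> drop m w \<in> B}
    = word_weight q A * word_weight q B"
proof (rule word_weight_eqI)
  have len: "u \<in> A \<Longrightarrow> length u = m" "v \<in> B \<Longrightarrow> length v = k" for u v
    using A B by auto
  have "((\<lambda>(u, v). q ^ sum_list u * q ^ sum_list v) has_sum word_weight q A * word_weight q B) (A \<times> B)"
    using q by (intro has_sum_times_nonneg word_weight_has_sum[OF q A] word_weight_has_sum[OF q B]) auto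
  also have "?this \<longleftrightarrow> ((\<lambda>w. q ^ sum_list w) has_sum word_weight q A * word_weight q B)
      {w. length w = m + k \<and> take m w \<in> A \<and> drop m w \<in> B}"
    by (rule has_sum_reindex_bij_witness[of _ "\<lambda>w. (take m w, drop m w)" "\<lambda>(u, v). u @ v"])
       (use len in \<open>auto simp: power_add\<close>)
  finally show "((\<lambda>w. q ^ sum_list w) has_sum word_weight q A * word_weight q B)
      {w. length w = m + k \<and> take m w \<in> A \<and> drop m w \<in> B}" .
qed

section \<open>Monotone chains with prescribed strict steps\<close>

text \<open>The list indices \<open>i\<close> and \<open>i + 1\<close> hold the letters \<open>i + 1\<close> and
  \<open>i + 2\<close> of the word.  The jump between them is indexed by \<open>i + 1\<close>, the number of
  letters that it raises, so that \<open>d\<close> has the indices of a major index.\<close>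

definition chains :: "nat \<Rightarrow> (nat \<Rightarrow> nat) \<Rightarrow> nat list set" where
  "chains m d = {w. length w = m \<and> (\<forall>i. Suc i < m \<longrightarrow> w ! Suc i + d (Suc i) \<le> w ! i)}"

lemma qpochhammer_nonzero:
  assumes "0 < q" "q \<noteq> 1"
  shows "qpochhammer q q m \<noteq> 0"
proof -
  have "1 - q * q ^ k \<noteq> 0" for k
    using assms power_less_one_iff[of q "Suc k"] one_less_power[of q "Suc k"]
    by (cases "q < 1") auto
  then show ?thesis unfolding qpochhammer_def by simp
qed

text \<open>All letters of a chain are at least its last letter, and all but the last are at least
  the last plus the last jump.  Subtracting that amount leaves a shorter chain.\<close>

lemma chains_Suc_iff:
  assumes "0 < m"
  shows "v @ [c] \<in> chains (Suc m) d \<longleftrightarrow>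
    (\<exists>u. u \<in> chains m d \<and> v = map (\<lambda>x. x + (c + d m)) u)"
proof
  assume *: "v @ [c] \<in> chains (Suc m) d"
  then have len: "length v = m" by (simp add: chains_def)
  have links: "(v @ [c]) ! Suc i + d (Suc i) \<le> (v @ [c]) ! i" if "Suc i < Suc m" for i
    using * that by (simp add: chains_def)
  have step: "v ! Suc i + d (Suc i) \<le> v ! i" if "Suc i < m" for i
    using links[of i] that len by (simp add: nth_append)
  obtain n where n: "m = Suc n" using assms by (cases m) auto
  have last: "c + d m \<le> v ! n"
    using links[of n] len n by (simp add: nth_append)
  have ge: "c + d m \<le> v ! (n - k)" if "k \<le> n" for k
    using that
  proof (induction k)
    case (Suc k)
    then have "Suc (n - Suc k) = n - k" by simp
    moreover have "Suc (n - Suc k) < m" using Suc.prems n by linarith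
    ultimately show ?case using step[of "n - Suc k"] Suc by (metis Suc_leD add_leD1 order_trans)
  qed (use last in simp)
  have ge: "c + d m \<le> v ! i" if "i < m" for i
    using ge[of "n - i"] that n by simp
  define u where "u = map (\<lambda>x. x - (c + d m)) v"
  have "v = map (\<lambda>x. x + (c + d m)) u"
    unfolding u_def using ge len by (auto intro!: nth_equalityI)
  moreover have "u \<in> chains m d"
    using step ge len by (fastforce simp: chains_def u_def)
  ultimately show "\<exists>u. u \<in> chains m d \<and> v = map (\<lambda>x. x + (c + d m)) u" by blast
next
  assume "\<exists>u. u \<in> chains m d \<and> v = map (\<lambda>x. x + (c + d m)) u"
  then obtain u where u: "u \<in> chains m d" "v = map (\<lambda>x. x + (c + d m)) u" by blast
  show "v @ [c] \<in> chains (Suc m) d"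
    unfolding chains_def
  proof (intro CollectI conjI allI impI)
    show "length (v @ [c]) = Suc m" using u by (simp add: chains_def)
    fix i assume "Suc i < Suc m"
    then consider "Suc i < m" | "Suc i = m" by linarith
    then show "(v @ [c]) ! Suc i + d (Suc i) \<le> (v @ [c]) ! i"
      using u by cases (auto simp: chains_def nth_append)
  qed
qed

lemma sum_list_map_add_const: "(\<Sum>x\<leftarrow>u. x + (c::nat)) = sum_list u + length u * c"
  by (induction u) auto

text \<open>Peeling off the last letter \<open>c\<close> of a chain of length \<open>m + 1\<close> as above, \<open>c\<close> is
  free and is counted \<open>m + 1\<close> times, giving the new factor \<open>1 / (1 - q\<^sup>m\<^sup>+\<^sup>1)\<close>, while the jump is counted
  \<open>m\<close> times.\<close>

lemma chains_weight_has_sum: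
  assumes q: "0 < q" "q < 1"
  shows "((\<lambda>w. q ^ sum_list w) has_sum q ^ (\<Sum>i\<in>{1..<m}. i * d i) / qpochhammer q q m) (chains m d)"
proof (induction m)
  case 0
  have "chains 0 d = {[]}" by (auto simp: chains_def)
  then show ?case by (simp add: qpochhammer_def has_sum_finiteI)
next
  case (Suc m)
  show ?case
  proof (cases "m = 0")
    case True
    have "((\<lambda>c. q ^ (1 * c)) has_sum 1 / (1 - q ^ 1)) UNIV"
      by (rule has_sum_power_geometric) (use q in auto)
    also have "?this \<longleftrightarrow> ((\<lambda>w. q ^ sum_list w) has_sum 1 / (1 - q ^ 1)) (chains (Suc m) d)"
      by (rule has_sum_reindex_bij_witness[of _ hd "\<lambda>c. [c]"])
         (auto simp: chains_def True length_Suc_conv)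
    finally show ?thesis by (simp add: qpochhammer_def True)
  next
    case False
    let ?h = "\<lambda>(u, c). map (\<lambda>x. x + (c + d m)) u @ [c]"
    have bij: "bij_betw ?h (chains m d \<times> UNIV) (chains (Suc m) d)"
      unfolding bij_betw_def
    proof
      show "inj_on ?h (chains m d \<times> UNIV)"
        by (auto simp: inj_on_def map_eq_conv inj_map_eq_map)
      show "?h ` (chains m d \<times> UNIV) = chains (Suc m) d"
      proof safe
        fix u c assume "u \<in> chains m d"
        then show "map (\<lambda>x. x + (c + d m)) u @ [c] \<in> chains (Suc m) d"
          using chains_Suc_iff[of m] False by blast
      next
        fix w assume w: "w \<in> chains (Suc m) d"
        then have "w \<noteq> []" by (auto simp: chains_def)
        then obtain v c where "w = v @ [c]" by (metis append_butlast_last_id)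
        then show "w \<in> ?h ` (chains m d \<times> UNIV)"
          using w chains_Suc_iff[of m v c d] False by force
      qed
    qed
    have "((\<lambda>(u, c). q ^ sum_list u * q ^ (Suc m * c)) has_sum
        (q ^ (\<Sum>i\<in>{1..<m}. i * d i) / qpochhammer q q m) * (1 / (1 - q ^ Suc m))) (chains m d \<times> UNIV)"
      using has_sum_power_geometric[of q "Suc m"] q by (intro has_sum_times_nonneg Suc) auto
    from has_sum_cmult_right[OF this, of "q ^ (m * d m)"]
    have "((\<lambda>(u, c). q ^ (m * d m) * (q ^ sum_list u * q ^ (Suc m * c))) has_sum
        q ^ (m * d m) * ((q ^ (\<Sum>i\<in>{1..<m}. i * d i) / qpochhammer q q m) * (1 / (1 - q ^ Suc m))))
        (chains m d \<times> UNIV)"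
      by (simp add: case_prod_unfold)
    also have "q ^ (m * d m) * ((q ^ (\<Sum>i\<in>{1..<m}. i * d i) / qpochhammer q q m) * (1 / (1 - q ^ Suc m)))
        = q ^ (\<Sum>i\<in>{1..<Suc m}. i * d i) / qpochhammer q q (Suc m)"
      using False by (simp add: qpochhammer_def power_add)
    also have "((\<lambda>(u, c). q ^ (m * d m) * (q ^ sum_list u * q ^ (Suc m * c))) has_sum
          q ^ (\<Sum>i\<in>{1..<Suc m}. i * d i) / qpochhammer q q (Suc m)) (chains m d \<times> UNIV) \<longleftrightarrow>
        ((\<lambda>x. q ^ sum_list (?h x)) has_sum
          q ^ (\<Sum>i\<in>{1..<Suc m}. i * d i) / qpochhammer q q (Suc m)) (chains m d \<times> UNIV)"
    proof (rule has_sum_cong, clarify)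
      fix u c assume "u \<in> chains m d"
      then have "sum_list (map (\<lambda>x. x + (c + d m)) u @ [c]) = m * d m + (sum_list u + Suc m * c)"
        by (simp only: sum_list_append sum_list_map_add_const) (simp add: chains_def algebra_simps)
      then show "q ^ (m * d m) * (q ^ sum_list u * q ^ (Suc m * c)) =
          q ^ sum_list (map (\<lambda>x. x + (c + d m)) u @ [c])"
        by (simp only: power_add)
    qed
    also have "\<dots> \<longleftrightarrow> ?thesis" by (rule has_sum_reindex_bij_betw[OF bij])
    finally show ?thesis .
  qed
qed

lemma chains_weight:
  assumes q: "0 < q" "q < 1"
  shows "word_weight q (chains m d) = q ^ (\<Sum>i\<in>{1..<m}. i * d i) / qpochhammer q q m"
  by (rule word_weight_eqI[OF chains_weight_has_sum[OF q]])

section \<open>Alternating words and their reciprocal series\<close>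

text \<open>Alternation with a relation that may depend on the position.  This is needed for words
  that follow one pattern up to some position and another one after it.\<close>

definition linked :: "(nat \<Rightarrow> nat \<Rightarrow> nat \<Rightarrow> bool) \<Rightarrow> nat list \<Rightarrow> bool" where
  "linked r w \<longleftrightarrow> (\<forall>i. Suc i < length w \<longrightarrow> r i (w ! i) (w ! Suc i))"

lemma alternating_eq_linked: "alternating \<alpha> \<beta> = linked (\<lambda>i. if even i then \<alpha> else \<beta>)"
  by (auto simp: alternating_def linked_def fun_eq_iff)

lemma linked_cong:
  assumes "\<And>i. Suc i < length w \<Longrightarrow> r i = s i"
  shows "linked r w \<longleftrightarrow> linked s w"
  using assms by (auto simp: linked_def)

lemma linked_take_drop:
  assumes "0 < m" "m < length w"
  shows "linked r w \<longleftrightarrow> linked r (take m w) \<and> linked (\<lambda>i. r (m + i)) (drop m w)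
    \<and> r (m - 1) (w ! (m - 1)) (w ! m)"
proof safe
  assume w: "linked r w"
  then show "linked r (take m w)" "linked (\<lambda>i. r (m + i)) (drop m w)"
    by (auto simp: linked_def)
  show "r (m - 1) (w ! (m - 1)) (w ! m)"
    using w assms unfolding linked_def by (metis Suc_diff_1)
next
  assume *: "linked r (take m w)" "linked (\<lambda>i. r (m + i)) (drop m w)"
    "r (m - 1) (w ! (m - 1)) (w ! m)"
  show "linked r w"
    unfolding linked_def
  proof (intro allI impI)
    fix i assume i: "Suc i < length w"
    consider "Suc i < m" | "Suc i = m" | j where "i = m + j"
      by (metis Suc_lessI le_Suc_ex linorder_not_less nat_less_le less_Suc_eq_le)
    then show "r i (w ! i) (w ! Suc i)"
    proof cases
      case 1
      then show ?thesis using *(1) i by (auto simp: linked_def dest!: spec[of _ i])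
    next
      case 2
      then show ?thesis using *(3) by auto
    next
      case (3 j)
      then show ?thesis using *(2) i by (auto simp: linked_def dest!: spec[of _ j])
    qed
  qed
qed

definition alt_words :: "(nat \<Rightarrow> nat \<Rightarrow> bool) \<Rightarrow> (nat \<Rightarrow> nat \<Rightarrow> bool) \<Rightarrow> nat \<Rightarrow> nat list set" where
  "alt_words \<alpha> \<beta> m = {w. length w = m \<and> alternating \<alpha> \<beta> w}"

lemma alt_words_length: "alt_words \<alpha> \<beta> m \<subseteq> {w. length w = m}"
  by (auto simp: alt_words_def)

lemma alt_words_0: "alt_words \<alpha> \<beta> 0 = {[]}"
  by (auto simp: alt_words_def alternating_def)

text \<open>Inclusion and exclusion over the links that follow even positions.  Let \<open>C k\<close> be the set of words whose
  first \<open>2k\<close> letters form an \<open>\<alpha>, \<not>\<beta>\<close> pattern and whose later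
  links follow \<open>\<alpha>, \<beta>\<close>.  The \<open>k\<close>-th product counts words with no condition
  on the link after position \<open>2k\<close>: if it satisfies \<open>\<beta>\<close> the word is in
  \<open>C k\<close>, otherwise in \<open>C (k + 1)\<close>.\<close>

theorem alt_words_weight_convolution:
  assumes q: "0 < q" "q < 1" and n: "0 < n"
  shows "(\<Sum>k\<le>n. (-1) ^ k * word_weight q (alt_words \<alpha> (\<lambda>x y. \<not> \<beta> x y) (2 * k))
      * word_weight q (alt_words \<alpha> \<beta> (2 * (n - k)))) = 0"
proof -
  define r where "r k i = (if even i then \<alpha> else if i < 2 * k - 1 then (\<lambda>x y. \<not> \<beta> x y) else \<beta>)"
    for k i :: nat
  define C where "C k = {w. length w = 2 * n \<and> linked (r k) w}" for k
  \<comment> \<open>The convention that both ends vanish makes the first and the last product fit the same pattern.\<close>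
  define c where "c k = (if k = 0 \<or> n < k then 0 else word_weight q (C k))" for k
  have C_len: "C k \<subseteq> {w. length w = 2 * n}" for k by (auto simp: C_def)
  have step: "word_weight q (alt_words \<alpha> (\<lambda>x y. \<not> \<beta> x y) (2 * k))
      * word_weight q (alt_words \<alpha> \<beta> (2 * (n - k))) = c k + c (Suc k)" if le: "k \<le> n" for k
  proof -
    consider "k = 0" | "k = n" | "0 < k" "k < n" using le by force
    then show ?thesis
    proof cases
      case 1
      have "alt_words \<alpha> \<beta> (2 * n) = C 1"
        unfolding alt_words_def C_def alternating_eq_linked
        by (intro Collect_cong conj_cong refl linked_cong) (auto simp: r_def odd_pos)
      then show ?thesis using 1 n
        by (simp add: c_def alt_words_0 word_weight_def)
    next
      case 2
      have "alt_words \<alpha> (\<lambda>x y. \<not> \<beta> x y) (2 * n) = C n"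
        unfolding alt_words_def C_def alternating_eq_linked
        by (intro Collect_cong conj_cong refl linked_cong) (auto simp: r_def)
      then show ?thesis using 2 n
        by (simp add: c_def alt_words_0 word_weight_def)
    next
      case 3
      let ?A = "alt_words \<alpha> (\<lambda>x y. \<not> \<beta> x y) (2 * k)" and ?B = "alt_words \<alpha> \<beta> (2 * (n - k))"
      have mem: "w \<in> C j \<longleftrightarrow> take (2 * k) w \<in> ?A \<and> drop (2 * k) w \<in> ?B \<and>
          (if j = k then \<beta> else (\<lambda>x y. \<not> \<beta> x y)) (w ! (2 * k - 1)) (w ! (2 * k))"
        if w: "length w = 2 * n" and j: "j = k \<or> j = Suc k" for w j
      proof -
        have "linked (r j) (take (2 * k) w) \<longleftrightarrow>
            linked (\<lambda>i. if even i then \<alpha> else (\<lambda>x y. \<not> \<beta> x y)) (take (2 * k) w)"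
          by (rule linked_cong) (use j w in \<open>auto simp: r_def\<close>)
        moreover have "linked (\<lambda>i. r j (2 * k + i)) (drop (2 * k) w) \<longleftrightarrow>
            linked (\<lambda>i. if even i then \<alpha> else \<beta>) (drop (2 * k) w)"
          by (rule linked_cong) (use j in \<open>auto simp: r_def fun_eq_iff elim!: oddE\<close>)
        moreover have "r j (2 * k - 1) = (if j = k then \<beta> else (\<lambda>x y. \<not> \<beta> x y))"
          using 3 j by (auto simp: r_def)
        ultimately show ?thesis
          using linked_take_drop[of "2 * k" w "r j"] w 3
          by (simp add: C_def alt_words_def alternating_eq_linked right_diff_distrib')
      qed
      have "word_weight q ?A * word_weight q ?B =
          word_weight q {w. length w = 2 * k + 2 * (n - k) \<and> take (2 * k) w \<in> ?A \<and> drop (2 * k) w \<in> ?B}"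
        by (rule word_weight_append[OF q alt_words_length alt_words_length, symmetric])
      also have "{w. length w = 2 * k + 2 * (n - k) \<and> take (2 * k) w \<in> ?A \<and> drop (2 * k) w \<in> ?B}
          = C k \<union> C (Suc k)"
      proof (rule set_eqI)
        fix w
        have len: "2 * k + 2 * (n - k) = 2 * n" using 3 by simp
        show "w \<in> {w. length w = 2 * k + 2 * (n - k) \<and> take (2 * k) w \<in> ?A \<and> drop (2 * k) w \<in> ?B}
            \<longleftrightarrow> w \<in> C k \<union> C (Suc k)"
        proof (cases "length w = 2 * n")
          case True
          then show ?thesis using mem[OF True, of k] mem[OF True, of "Suc k"] len by auto
        next
          case False
          then show ?thesis using len by (simp add: C_def)
        qed
      qed
      also have "word_weight q (C k \<union> C (Suc k)) = word_weight q (C k) + word_weight q (C (Suc k))"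
      proof (rule word_weight_Un_disjoint[OF q C_len C_len])
        show "C k \<inter> C (Suc k) = {}"
        proof (rule equals0I)
          fix w assume "w \<in> C k \<inter> C (Suc k)"
          moreover from this have "length w = 2 * n" by (simp add: C_def)
          ultimately show False using mem[of w k] mem[of w "Suc k"] by auto
        qed
      qed
      finally show ?thesis using 3 by (simp add: c_def)
    qed
  qed
  have "(\<Sum>k\<le>n. (-1) ^ k * word_weight q (alt_words \<alpha> (\<lambda>x y. \<not> \<beta> x y) (2 * k))
      * word_weight q (alt_words \<alpha> \<beta> (2 * (n - k)))) = (\<Sum>k\<le>n. (-1) ^ k * (c k + c (Suc k)))"
    using step by (intro sum.cong refl) (simp only: atMost_iff mult.assoc)
  also have "\<dots> = c 0 + (-1) ^ n * c (Suc n)"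
    by (induction n) (auto simp: algebra_simps)
  also have "\<dots> = 0" by (simp add: c_def)
  finally show ?thesis .
qed

section \<open>The probability of an alternating word\<close>

lemma pmf_replicate_pmf:
  "pmf (replicate_pmf (length w) p) w = prod_list (map (pmf p) w)"
proof (induction w)
  case (Cons x w)
  have "replicate_pmf (Suc n) p = map_pmf (\<lambda>(x, xs). x # xs) (pair_pmf p (replicate_pmf n p))" for n
    by (simp add: pair_pmf_def map_pmf_def bind_assoc_pmf bind_return_pmf)
  moreover have "pmf (map_pmf (\<lambda>(x, xs). x # xs) (pair_pmf p (replicate_pmf n p))) ((\<lambda>(x, xs). x # xs) (x, w))
      = pmf (pair_pmf p (replicate_pmf n p)) (x, w)" for n
    by (rule pmf_map_inj') (auto simp: inj_on_def)
  ultimately show ?case using Cons by (simp add: pmf_pair)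
qed simp

lemma map_replicate_pmf: "replicate_pmf m (map_pmf g p) = map_pmf (map g) (replicate_pmf m p)"
  by (induction m) (simp_all add: map_bind_pmf bind_map_pmf)

text \<open>The relations compare letters only with each other, so the shift of all letters by one
  does not change the event.\<close>

lemma tau_eq_word_weight:
  assumes q: "0 < q" "q < 1"
    and shift: "\<And>x y. \<alpha> (Suc x) (Suc y) = \<alpha> x y" "\<And>x y. \<beta> (Suc x) (Suc y) = \<beta> x y"
  shows "tau \<alpha> \<beta> m q = (1 - q) ^ m * word_weight q (alt_words \<alpha> \<beta> m)"
proof -
  let ?R = "replicate_pmf m (geometric_pmf (1 - q))"
  have set: "set_pmf ?R = {w. length w = m}"
    using q by (auto simp: set_replicate_pmf set_pmf_geometric)
  have "tau \<alpha> \<beta> m q = measure_pmf.prob ?R (map Suc -` {w. alternating \<alpha> \<beta> w})"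
    by (simp add: tau_def letter_pmf_def map_replicate_pmf)
  also have "map Suc -` {w. alternating \<alpha> \<beta> w} = {w. alternating \<alpha> \<beta> w}"
    by (auto simp: alternating_def shift)
  also have "measure_pmf.prob ?R {w. alternating \<alpha> \<beta> w}
      = measure_pmf.prob ?R ({w. alternating \<alpha> \<beta> w} \<inter> set_pmf ?R)"
    by (simp add: measure_Int_set_pmf)
  also have "{w. alternating \<alpha> \<beta> w} \<inter> set_pmf ?R = alt_words \<alpha> \<beta> m"
    by (auto simp: set alt_words_def)
  also have "measure_pmf.prob ?R (alt_words \<alpha> \<beta> m) = infsum (pmf ?R) (alt_words \<alpha> \<beta> m)"
    by (simp add: measure_pmf_conv_infsetsum infsetsum_infsum pmf_abs_summable)
  also have "\<dots> = infsum (\<lambda>w. (1 - q) ^ m * q ^ sum_list w) (alt_words \<alpha> \<beta> m)"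
  proof (rule infsum_cong)
    fix w assume "w \<in> alt_words \<alpha> \<beta> m"
    then have "length w = m" by (simp add: alt_words_def)
    moreover have "prod_list (map (pmf (geometric_pmf (1 - q))) w) = (1 - q) ^ length w * q ^ sum_list w"
      using q by (induction w) (simp_all add: power_add)
    ultimately show "pmf ?R w = (1 - q) ^ m * q ^ sum_list w"
      using pmf_replicate_pmf[of w "geometric_pmf (1 - q)"] by simp
  qed
  also have "\<dots> = (1 - q) ^ m * word_weight q (alt_words \<alpha> \<beta> m)"
    unfolding word_weight_def by (rule infsum_cmult_right')
  finally show ?thesis .
qed

section \<open>Alternating chains\<close>

lemma word_weight_rev: "word_weight q (rev ` A) = word_weight q A"
proof -
  have "word_weight q (rev ` A) = infsum ((\<lambda>w. q ^ sum_list w) \<circ> rev) A"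
    unfolding word_weight_def by (rule infsum_reindex) (simp add: inj_on_def)
  then show ?thesis by (simp add: word_weight_def o_def sum_list_rev)
qed

text \<open>For even length the number of links is odd, so that reversal keeps the parity of the
  links and only turns each relation around.\<close>

lemma alternating_rev:
  assumes "even (length w)"
  shows "alternating \<alpha> \<beta> (rev w) \<longleftrightarrow> alternating (\<lambda>x y. \<alpha> y x) (\<lambda>x y. \<beta> y x) w"
proof -
  have *: "alternating (\<lambda>x y. \<alpha> y x) (\<lambda>x y. \<beta> y x) w"
    if "alternating \<alpha> \<beta> (rev w)" "even (length w)" for \<alpha> \<beta> :: "nat \<Rightarrow> nat \<Rightarrow> bool" and w
    unfolding alternating_def
  proof (intro allI impI)
    fix i assume i: "Suc i < length w"
    define j where "j = length w - 2 - i"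
    have j: "Suc j < length w" "even j \<longleftrightarrow> even i" "rev w ! j = w ! Suc i" "rev w ! Suc j = w ! i"
      using i that(2) by (auto simp: j_def rev_nth Suc_diff_Suc)
    then show "(if even i then \<lambda>x y. \<alpha> y x else (\<lambda>x y. \<beta> y x)) (w ! i) (w ! Suc i)"
      using that(1) by (auto simp: alternating_def dest!: spec[of _ j])
  qed
  show ?thesis using *[of \<alpha> \<beta> w] *[of "\<lambda>x y. \<alpha> y x" "\<lambda>x y. \<beta> y x" "rev w"] assms by auto
qed

lemma alt_words_rev:
  assumes "even m"
  shows "word_weight q (alt_words \<alpha> \<beta> m) = word_weight q (alt_words (\<lambda>x y. \<alpha> y x) (\<lambda>x y. \<beta> y x) m)"
proof -
  have "alt_words \<alpha> \<beta> m = rev ` alt_words (\<lambda>x y. \<alpha> y x) (\<lambda>x y. \<beta> y x) m"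
    using assms by (auto simp: alt_words_def image_iff alternating_rev intro!: exI[of _ "rev _"])
  then show ?thesis by (simp add: word_weight_rev)
qed

text \<open>The relation \<open>y + a \<le> x\<close> is the weak inequality for \<open>a = 0\<close> and the strict one for
  \<open>a = 1\<close>; this treats all six patterns at once.\<close>

lemma alt_words_eq_chains:
  "alt_words (\<lambda>x y. y + a \<le> x) (\<lambda>x y. y + b \<le> x) m = chains m (\<lambda>i. if odd i then a else b)"
  by (auto simp: alt_words_def chains_def alternating_def)

lemma sum_alternating_exponents:
  "(\<Sum>i\<in>{1..<2 * k}. i * (if odd i then a else b)) = k * k * a + k * (k - 1) * (b :: nat)"
proof (induction k)
  case (Suc k)
  show ?case
  proof (cases "k = 0")
    case True
    have "{1..<2 * Suc 0} = {1}" by auto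
    then show ?thesis using True by simp
  next
    case False
    then have "{1..<2 * Suc k} = insert (2 * k) (insert (2 * k + 1) {1..<2 * k})" by auto
    then have "(\<Sum>i\<in>{1..<2 * Suc k}. i * (if odd i then a else b))
        = 2 * k * b + ((2 * k + 1) * a + (k * k * a + k * (k - 1) * b))"
      using Suc by simp
    with False show ?thesis by (cases k) (auto simp: algebra_simps)
  qed
qed simp

lemma alt_words_chain_weight:
  assumes q: "0 < q" "q < 1"
  shows "word_weight q (alt_words (\<lambda>x y. y + a \<le> x) (\<lambda>x y. y + b \<le> x) (2 * k))
    = q ^ (k * k * a + k * (k - 1) * b) / qpochhammer q q (2 * k)"
  by (simp only: alt_words_eq_chains chains_weight[OF q] sum_alternating_exponents)

section \<open>Fillings of zigzag shapes\<close>

text \<open>Reading the cells of a shape in the order \<open>cell 0, cell 1, \<dots>\<close> identifies fillings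
  with words, whatever the shape is.\<close>

lemma has_sum_fillings:
  assumes q: "0 < q" "q < 1"
    and cell: "bij_betw cell {..<m} D"
    and fill: "\<And>T. T \<in> D \<rightarrow>\<^sub>E UNIV \<Longrightarrow>
      T \<in> fillings R K D \<longleftrightarrow> alternating \<alpha> \<beta> (map (T \<circ> cell) [0..<m])"
  shows "((\<lambda>T. q ^ (\<Sum>c\<in>D. T c)) has_sum word_weight q (alt_words \<alpha> \<beta> m)) (fillings R K D)"
proof -
  define index where "index = the_inv_into {..<m} cell"
  have inj: "inj_on cell {..<m}" and D: "D = cell ` {..<m}" using cell by (auto simp: bij_betw_def)
  have index: "index (cell i) = i" if "i < m" for i
    unfolding index_def using that inj by (simp add: the_inv_into_f_f)
  have index': "index c < m" "cell (index c) = c" if "c \<in> D" for c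
    using that index by (auto simp: D)
  have "((\<lambda>w. q ^ sum_list w) has_sum word_weight q (alt_words \<alpha> \<beta> m)) (alt_words \<alpha> \<beta> m)"
    by (rule word_weight_has_sum[OF q alt_words_length])
  also have "?this \<longleftrightarrow> ?thesis"
  proof (rule has_sum_reindex_bij_witness[of _ "\<lambda>T. map (T \<circ> cell) [0..<m]"
        "\<lambda>w. \<lambda>c\<in>D. w ! index c"])
    fix w assume w: "w \<in> alt_words \<alpha> \<beta> m"
    then have len: "length w = m" by (simp add: alt_words_def)
    show *: "map ((\<lambda>c\<in>D. w ! index c) \<circ> cell) [0..<m] = w"
      by (rule nth_equalityI) (auto simp: len D index)
    show "(\<lambda>c\<in>D. w ! index c) \<in> fillings R K D"
      using w by (subst fill) (simp_all only: *, auto simp: alt_words_def)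
    have "(\<Sum>c\<in>D. (\<lambda>c\<in>D. w ! index c) c) = (\<Sum>i<m. w ! i)"
      using inj by (simp add: D sum.reindex index)
    then show "q ^ (\<Sum>c\<in>D. (\<lambda>c\<in>D. w ! index c) c) = q ^ sum_list w"
      by (simp add: sum_list_sum_nth len lessThan_atLeast0)
  next
    fix T assume T: "T \<in> fillings R K D"
    then have T': "T \<in> D \<rightarrow>\<^sub>E UNIV" by (simp add: fillings_def)
    show "map (T \<circ> cell) [0..<m] \<in> alt_words \<alpha> \<beta> m"
      using fill[OF T'] T by (simp add: alt_words_def)
    show "(\<lambda>c\<in>D. map (T \<circ> cell) [0..<m] ! index c) = T"
      using T' index' by (auto simp: fun_eq_iff PiE_def extensional_def restrict_def)
  qed (rule refl)
  finally show ?thesis .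
qed

lemma alternating_even_length:
  assumes "length w = 2 * n"
  shows "alternating \<alpha> \<beta> w \<longleftrightarrow>
    (\<forall>i<n. \<alpha> (w ! (2 * i)) (w ! (2 * i + 1))) \<and>
    (\<forall>i. Suc i < n \<longrightarrow> \<beta> (w ! (2 * i + 1)) (w ! (2 * i + 2)))"
proof -
  have "alternating \<alpha> \<beta> w \<longleftrightarrow>
      (\<forall>i. Suc (2 * i) < 2 * n \<longrightarrow> \<alpha> (w ! (2 * i)) (w ! Suc (2 * i))) \<and>
      (\<forall>i. Suc (2 * i + 1) < 2 * n \<longrightarrow> \<beta> (w ! (2 * i + 1)) (w ! Suc (2 * i + 1)))"
    (is "_ \<longleftrightarrow> ?E \<and> ?O")
  proof
    assume *: "alternating \<alpha> \<beta> w"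
    have "?E"
      using * assms unfolding alternating_def by (metis dvd_triv_left)
    moreover have "?O"
      using * assms unfolding alternating_def by (metis dvd_triv_left even_plus_one_iff)
    ultimately show "?E \<and> ?O" ..
  next
    assume *: "?E \<and> ?O"
    show "alternating \<alpha> \<beta> w"
      unfolding alternating_def
    proof (intro allI impI)
      fix i assume i: "Suc i < length w"
      show "(if even i then \<alpha> else \<beta>) (w ! i) (w ! Suc i)"
      proof (cases "even i")
        case True
        then obtain k where "i = 2 * k" by (rule evenE)
        then show ?thesis using * i assms by simp
      next
        case False
        then obtain k where "i = 2 * k + 1" by (rule oddE)
        then show ?thesis using * i assms by simp
      qed
    qed
  qed
  then show ?thesis by (auto simp: Suc_less_eq)
qed

text \<open>Both shapes consist of cells on two neighbouring antidiagonals, and they are transposes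
  of each other.\<close>

lemma skew_delta01: "skew (delta01 (n + 2)) (delta n) = {(i, j). i < n \<and> n \<le> i + j + 1 \<and> i + j \<le> n}"
proof -
  have d: "delta01 (n + 2) = rev [2..<n + 2]" by (simp add: delta01_def del: upt_Suc)
  have "diagram (delta01 (n + 2)) = {(i, j). i < n \<and> i + j \<le> n}"
    by (auto simp: d diagram_def rev_nth simp del: upt_Suc add_2_eq_Suc')
  moreover have "diagram (delta n) = {(i, j). i + j + 1 < n}"
    by (auto simp: diagram_def delta_def rev_nth simp del: upt_Suc)
  ultimately show ?thesis by (auto simp: skew_def)
qed

lemma skew_delta10: "skew (delta10 (n + 2)) (delta n) = {(i, j). j < n \<and> n \<le> i + j + 1 \<and> i + j \<le> n}"
proof -
  have "diagram (delta10 (n + 2)) = {(i, j). j < n \<and> i + j \<le> n}"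
  proof (cases "n = 0")
    case False
    then have d: "delta10 (n + 2) = n # rev [1..<n + 1]" by (simp add: delta10_def del: upt_Suc)
    show ?thesis
      by (auto simp: d diagram_def rev_nth nth_Cons' simp del: upt_Suc add_2_eq_Suc' split: if_splits)
  qed (simp add: delta10_def diagram_def)
  moreover have "diagram (delta n) = {(i, j). i + j + 1 < n}"
    by (auto simp: diagram_def delta_def rev_nth simp del: upt_Suc)
  ultimately show ?thesis by (auto simp: skew_def)
qed

text \<open>The ribbon is read from its top right cell: one step to the left, one step down, and so
  on.  A step to the left reverses the row relation.\<close>

lemma fillings_delta01:
  assumes q: "0 < q" "q < 1"
  shows "((\<lambda>T. q ^ (\<Sum>c\<in>skew (delta01 (n + 2)) (delta n). T c)) has_sum
      word_weight q (alt_words (\<lambda>x y. R y x) K (2 * n))) (fillings R K (skew (delta01 (n + 2)) (delta n)))"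
proof (rule has_sum_fillings[OF q])
  let ?D = "skew (delta01 (n + 2)) (delta n)"
  let ?cell = "\<lambda>k. (k div 2, if even k then n - k div 2 else n - k div 2 - 1)"
  show "bij_betw ?cell {..<2 * n} ?D"
  proof (rule bij_betw_byWitness[where f' = "\<lambda>(i, j). 2 * i + (n - (i + j))"])
    show "\<forall>k\<in>{..<2 * n}. (case ?cell k of (i, j) \<Rightarrow> 2 * i + (n - (i + j))) = k"
      by (auto elim!: evenE oddE)
    show "?cell ` {..<2 * n} \<subseteq> ?D"
      by (auto simp: skew_delta01 simp del: add_2_eq_Suc' elim!: evenE oddE)
    have *: "?cell (2 * i + (n - (i + j))) = (i, j) \<and> 2 * i + (n - (i + j)) < 2 * n" if "(i, j) \<in> ?D" for i j
    proof -
      from that consider "i < n" "i + j = n" | "i < n" "i + j + 1 = n"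
        by (fastforce simp: skew_delta01 simp del: add_2_eq_Suc')
      then show ?thesis by cases auto
    qed
    show "\<forall>c\<in>?D. ?cell (case c of (i, j) \<Rightarrow> 2 * i + (n - (i + j))) = c"
      using * by fast
    show "(\<lambda>(i, j). 2 * i + (n - (i + j))) ` ?D \<subseteq> {..<2 * n}"
      using * by fast
  qed
  fix T :: "nat \<times> nat \<Rightarrow> nat" assume T: "T \<in> ?D \<rightarrow>\<^sub>E UNIV"
  let ?w = "map (T \<circ> ?cell) [0..<2 * n]"
  have "alternating (\<lambda>x y. R y x) K ?w \<longleftrightarrow>
      (\<forall>i<n. R (T (i, n - i - 1)) (T (i, n - i))) \<and>
      (\<forall>i. Suc i < n \<longrightarrow> K (T (i, n - i - 1)) (T (Suc i, n - Suc i)))"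
    by (subst alternating_even_length[of _ n]) auto
  also have "(\<forall>i<n. R (T (i, n - i - 1)) (T (i, n - i))) \<longleftrightarrow>
      (\<forall>i j j'. (i, j) \<in> ?D \<longrightarrow> (i, j') \<in> ?D \<longrightarrow> j < j' \<longrightarrow> R (T (i, j)) (T (i, j')))" (is "?l = ?r")
  proof
    assume ?l
    show ?r
    proof (intro allI impI)
      fix i j j' assume "(i, j) \<in> ?D" "(i, j') \<in> ?D" "j < j'"
      then have "i < n" "j = n - i - 1" "j' = n - i" by (auto simp: skew_delta01 simp del: add_2_eq_Suc')
      with \<open>?l\<close> show "R (T (i, j)) (T (i, j'))" by blast
    qed
  qed (auto simp: skew_delta01 simp del: add_2_eq_Suc')
  also have "(\<forall>i. Suc i < n \<longrightarrow> K (T (i, n - i - 1)) (T (Suc i, n - Suc i))) \<longleftrightarrow>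
      (\<forall>i i' j. (i, j) \<in> ?D \<longrightarrow> (i', j) \<in> ?D \<longrightarrow> i < i' \<longrightarrow> K (T (i, j)) (T (i', j)))" (is "?l = ?r")
  proof
    assume ?l
    show ?r
    proof (intro allI impI)
      fix i i' j assume "(i, j) \<in> ?D" "(i', j) \<in> ?D" "i < i'"
      then have "Suc i < n" "j = n - i - 1" "j = n - Suc i" "i' = Suc i" by (auto simp: skew_delta01 simp del: add_2_eq_Suc')
      with \<open>?l\<close> show "K (T (i, j)) (T (i', j))" by metis
    qed
  qed (auto simp: skew_delta01 simp del: add_2_eq_Suc')
  finally show "T \<in> fillings R K ?D \<longleftrightarrow> alternating (\<lambda>x y. R y x) K ?w"
    using T unfolding fillings_def by blast
qed

text \<open>The ribbon is again read from its top right cell, now starting with a step down.\<close>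

lemma fillings_delta10:
  assumes q: "0 < q" "q < 1"
  shows "((\<lambda>T. q ^ (\<Sum>c\<in>skew (delta10 (n + 2)) (delta n). T c)) has_sum
      word_weight q (alt_words K (\<lambda>x y. R y x) (2 * n))) (fillings R K (skew (delta10 (n + 2)) (delta n)))"
proof (rule has_sum_fillings[OF q])
  let ?D = "skew (delta10 (n + 2)) (delta n)"
  let ?cell = "\<lambda>k. (if even k then k div 2 else Suc (k div 2), n - 1 - k div 2)"
  show "bij_betw ?cell {..<2 * n} ?D"
  proof (rule bij_betw_byWitness[where f' = "\<lambda>(i, j). 2 * (n - 1 - j) + (i + j + 1 - n)"])
    show "\<forall>k\<in>{..<2 * n}. (case ?cell k of (i, j) \<Rightarrow> 2 * (n - 1 - j) + (i + j + 1 - n)) = k"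
      by (auto elim!: evenE oddE)
    show "?cell ` {..<2 * n} \<subseteq> ?D"
      by (auto simp: skew_delta10 simp del: add_2_eq_Suc' elim!: evenE oddE)
    have *: "?cell (2 * (n - 1 - j) + (i + j + 1 - n)) = (i, j) \<and> 2 * (n - 1 - j) + (i + j + 1 - n) < 2 * n" if "(i, j) \<in> ?D" for i j
    proof -
      from that consider "j < n" "i + j = n" | "j < n" "i + j + 1 = n"
        by (fastforce simp: skew_delta10 simp del: add_2_eq_Suc')
      then show ?thesis by cases auto
    qed
    show "\<forall>c\<in>?D. ?cell (case c of (i, j) \<Rightarrow> 2 * (n - 1 - j) + (i + j + 1 - n)) = c"
      using * by fast
    show "(\<lambda>(i, j). 2 * (n - 1 - j) + (i + j + 1 - n)) ` ?D \<subseteq> {..<2 * n}"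
      using * by fast
  qed
  fix T :: "nat \<times> nat \<Rightarrow> nat" assume T: "T \<in> ?D \<rightarrow>\<^sub>E UNIV"
  let ?w = "map (T \<circ> ?cell) [0..<2 * n]"
  have "alternating K (\<lambda>x y. R y x) ?w \<longleftrightarrow>
      (\<forall>i<n. K (T (i, n - 1 - i)) (T (Suc i, n - 1 - i))) \<and>
      (\<forall>i. Suc i < n \<longrightarrow> R (T (Suc i, n - 1 - Suc i)) (T (Suc i, n - 1 - i)))"
    by (subst alternating_even_length[of _ n]) auto
  also have "(\<forall>i<n. K (T (i, n - 1 - i)) (T (Suc i, n - 1 - i))) \<longleftrightarrow>
      (\<forall>i i' j. (i, j) \<in> ?D \<longrightarrow> (i', j) \<in> ?D \<longrightarrow> i < i' \<longrightarrow> K (T (i, j)) (T (i', j)))" (is "?l = ?r")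
  proof
    assume ?l
    show ?r
    proof (intro allI impI)
      fix i i' j assume "(i, j) \<in> ?D" "(i', j) \<in> ?D" "i < i'"
      then have "i < n" "j = n - 1 - i" "i' = Suc i" by (auto simp: skew_delta10 simp del: add_2_eq_Suc')
      with \<open>?l\<close> show "K (T (i, j)) (T (i', j))" by blast
    qed
  qed (auto simp: skew_delta10 simp del: add_2_eq_Suc')
  also have "(\<forall>i. Suc i < n \<longrightarrow> R (T (Suc i, n - 1 - Suc i)) (T (Suc i, n - 1 - i))) \<longleftrightarrow>
      (\<forall>i j j'. (i, j) \<in> ?D \<longrightarrow> (i, j') \<in> ?D \<longrightarrow> j < j' \<longrightarrow> R (T (i, j)) (T (i, j')))" (is "?l = ?r")
  proof
    assume ?l
    show ?r
    proof (intro allI impI)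
      fix i j j' assume *: "(i, j) \<in> ?D" "(i, j') \<in> ?D" "j < j'"
      then obtain k where "i = Suc k" by (cases i) (auto simp: skew_delta10 simp del: add_2_eq_Suc')
      with * have "Suc k < n" "j = n - 1 - Suc k" "j' = n - 1 - k" by (auto simp: skew_delta10 simp del: add_2_eq_Suc')
      with \<open>?l\<close> \<open>i = Suc k\<close> show "R (T (i, j)) (T (i, j'))" by blast
    qed
  next
    assume ?r
    show ?l
    proof (intro allI impI)
      fix i assume "Suc i < n"
      then have "(Suc i, n - 1 - Suc i) \<in> ?D" "(Suc i, n - 1 - i) \<in> ?D" "n - 1 - Suc i < n - 1 - i"
        by (auto simp: skew_delta10 simp del: add_2_eq_Suc')
      with \<open>?r\<close> show "R (T (Suc i, n - 1 - Suc i)) (T (Suc i, n - 1 - i))" by blast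
    qed
  qed
  finally show "T \<in> fillings R K ?D \<longleftrightarrow> alternating K (\<lambda>x y. R y x) ?w"
    using T unfolding fillings_def by blast
qed

section \<open>The involutions eta and kappa\<close>

lemma foldr_comp_append: "foldr (\<circ>) (fs @ [g]) id = foldr (\<circ>) fs id \<circ> g"
  by (induction fs) (auto simp: fun_eq_iff)

lemma eta_apply: "eta n k = (if 1 \<le> k \<and> k \<le> 2 * n then if odd k then k + 1 else k - 1 else k)"
proof (induction n arbitrary: k)
  case 0
  show ?case by (simp add: eta_def)
next
  case (Suc n)
  have "eta (Suc n) = eta n \<circ> Transposition.transpose (2 * n + 1) (2 * n + 2)"
    by (simp add: eta_def foldr_comp_append del: foldr_append)
  then show ?case
    by (cases "k \<le> 2 * n") (auto simp: Suc Transposition.transpose_def le_Suc_eq)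
qed

lemma kappa_apply: "kappa n k = (if 2 \<le> k \<and> k < 2 * n then if even k then k + 1 else k - 1 else k)"
proof (induction n arbitrary: k)
  case 0
  show ?case by (simp add: kappa_def)
next
  case (Suc n)
  show ?case
  proof (cases "n = 0")
    case True
    then show ?thesis by (simp add: kappa_def)
  next
    case False
    then have "kappa (Suc n) = kappa n \<circ> Transposition.transpose (2 * n) (2 * n + 1)"
      by (simp add: kappa_def foldr_comp_append del: foldr_append)
    then show ?thesis
      using False by (cases "k < 2 * n") (auto simp: Suc Transposition.transpose_def less_Suc_eq)
  qed
qed

section \<open>The permutation that sorts a word\<close>

text \<open>The order in which the positions are sorted: larger letters come first, and equal letters
  are ordered by the labels \<open>\<omega>\<close>.  Positions are counted from 1.\<close>

definition precedes :: "(nat \<Rightarrow> nat) \<Rightarrow> nat list \<Rightarrow> nat \<Rightarrow> nat \<Rightarrow> bool" where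
  "precedes \<omega> w i j \<longleftrightarrow> w ! (j - 1) < w ! (i - 1) \<or> w ! (i - 1) = w ! (j - 1) \<and> \<omega> i < \<omega> j"

text \<open>The permutation sends each position to its rank, so its inverse lists the positions in
  sorted order.\<close>

definition ranks :: "(nat \<Rightarrow> nat) \<Rightarrow> nat list \<Rightarrow> (nat \<Rightarrow> nat) \<Rightarrow> bool" where
  "ranks \<omega> w \<pi> \<longleftrightarrow> \<pi> permutes {1..length w} \<and>
    (\<forall>i\<in>{1..length w}. \<forall>j\<in>{1..length w}. \<pi> i < \<pi> j \<longleftrightarrow> precedes \<omega> w i j)"

lemma precedes_trans: "precedes \<omega> w i j \<Longrightarrow> precedes \<omega> w j k \<Longrightarrow> precedes \<omega> w i k"
  by (auto simp: precedes_def)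

lemma precedes_asym: "precedes \<omega> w i j \<Longrightarrow> \<not> precedes \<omega> w j i"
  by (auto simp: precedes_def)

lemma precedes_total:
  assumes "inj_on \<omega> S" "i \<in> S" "j \<in> S" "i \<noteq> j"
  shows "precedes \<omega> w i j \<or> precedes \<omega> w j i"
proof -
  have "\<omega> i \<noteq> \<omega> j" using assms by (auto simp: inj_on_def)
  then show ?thesis
    unfolding precedes_def
    by (cases "w ! (i - 1)" "w ! (j - 1)" rule: linorder_cases) (auto simp: neq_iff)
qed

text \<open>A permutation of \<open>{1..N}\<close> is determined by the order of its values.  This gives
  the uniqueness of the ranking.\<close>

lemma permutation_apply_eq_card:
  assumes "\<pi> permutes {1..N}" "j \<in> {1..N}"
  shows "\<pi> j = card {i \<in> {1..N}. \<pi> i \<le> \<pi> j}"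
proof -
  have "\<pi> ` {i \<in> {1..N}. \<pi> i \<le> \<pi> j} = {1..\<pi> j}"
  proof safe
    fix k assume "k \<in> {1..\<pi> j}"
    moreover have "\<pi> j \<in> {1..N}" using assms(2) permutes_in_image[OF assms(1)] by blast
    ultimately have "k \<in> {1..N}" by auto
    then obtain i where "i \<in> {1..N}" "\<pi> i = k"
      using permutes_image[OF assms(1)] by (metis imageE)
    then show "k \<in> \<pi> ` {i \<in> {1..N}. \<pi> i \<le> \<pi> j}" using \<open>k \<in> {1..\<pi> j}\<close> by auto
  next
    fix i assume "i \<in> {1..N}"
    then have "\<pi> i \<in> {1..N}" using assms(2) permutes_in_image[OF assms(1)] by blast
    moreover assume "\<pi> i \<le> \<pi> j"
    ultimately show "\<pi> i \<in> {1..\<pi> j}" by auto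
  qed
  then have "card {1..\<pi> j} = card {i \<in> {1..N}. \<pi> i \<le> \<pi> j}"
    using card_image[OF permutes_inj_on[OF assms(1)]] by metis
  then show ?thesis by simp
qed

lemma ranks_unique:
  assumes "ranks \<omega> w \<pi>" "ranks \<omega> w \<rho>"
  shows "\<pi> = \<rho>"
proof
  fix j
  have perm: "\<pi> permutes {1..length w}" "\<rho> permutes {1..length w}"
    using assms by (auto simp: ranks_def)
  show "\<pi> j = \<rho> j"
  proof (cases "j \<in> {1..length w}")
    case True
    then have "{i \<in> {1..length w}. \<pi> i \<le> \<pi> j} = {i \<in> {1..length w}. \<rho> i \<le> \<rho> j}"
      using assms by (auto simp: ranks_def not_less[symmetric])
    then show ?thesis using permutation_apply_eq_card[OF _ True] perm by metis
  next
    case False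
    then show ?thesis using perm by (metis permutes_not_in)
  qed
qed

lemma ranks_exists:
  assumes inj: "inj_on \<omega> {1..length w}"
  shows "\<exists>\<pi>. ranks \<omega> w \<pi>"
proof -
  let ?S = "{1..length w}"
  define below where "below j = {i \<in> ?S. \<not> precedes \<omega> w j i}" for j
  define \<pi> where "\<pi> j = (if j \<in> ?S then card (below j) else j)" for j
  have less: "\<pi> i < \<pi> j" if "precedes \<omega> w i j" "i \<in> ?S" "j \<in> ?S" for i j
  proof -
    have "below i \<subseteq> below j"
      by (auto simp: below_def dest: precedes_trans[OF that(1)])
    moreover have "j \<in> below j" "j \<notin> below i"
      using that precedes_asym[of \<omega> w j j] by (auto simp: below_def)
    ultimately have "below i \<subset> below j" by blast
    moreover have "finite (below j)" by (simp add: below_def)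
    ultimately show ?thesis using that by (simp add: \<pi>_def psubset_card_mono)
  qed
  have iff: "\<pi> i < \<pi> j \<longleftrightarrow> precedes \<omega> w i j" if "i \<in> ?S" "j \<in> ?S" for i j
  proof (cases "i = j")
    case True
    then show ?thesis using precedes_asym[of \<omega> w i i] by auto
  next
    case False
    then show ?thesis
      using less[of i j] less[of j i] that precedes_total[OF inj that False, of w] by auto
  qed
  have "inj_on \<pi> ?S"
  proof (rule inj_onI, rule ccontr)
    fix i j assume ij: "i \<in> ?S" "j \<in> ?S" "\<pi> i = \<pi> j" "i \<noteq> j"
    then show False
      using less[of i j] less[of j i] precedes_total[OF inj ij(1,2,4), of w] by auto
  qed
  moreover have "\<pi> ` ?S \<subseteq> ?S"
  proof safe
    fix j assume j: "j \<in> ?S"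
    have "j \<in> below j" using j by (auto simp: below_def precedes_def)
    moreover have "below j \<subseteq> ?S" by (auto simp: below_def)
    ultimately have "0 < card (below j)" "card (below j) \<le> card ?S"
      using card_mono[of ?S "below j"] finite_subset[of "below j" ?S] by (auto simp: card_gt_0_iff)
    then show "\<pi> j \<in> ?S" using j by (simp add: \<pi>_def)
  qed
  ultimately have "\<pi> permutes ?S"
    by (intro inj_imp_permutes) (auto simp: \<pi>_def image_subset_iff)
  then show ?thesis using iff by (auto simp: ranks_def)
qed

text \<open>Sortedness of a list follows from sortedness of neighbours.  Between neighbours whose
  labels increase a tie is allowed; where the labels decrease the letter must drop.\<close>

lemma ranks_iff_sorted:
  assumes len: "length w = N" and \<pi>: "\<pi> permutes {1..N}" and inj: "inj_on \<omega> {1..N}"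
  shows "ranks \<omega> w \<pi> \<longleftrightarrow>
    map (\<lambda>i. w ! (inv \<pi> i - 1)) [1..<Suc N]
      \<in> chains N (\<lambda>i. if \<omega> (inv \<pi> (Suc i)) < \<omega> (inv \<pi> i) then 1 else 0)"
proof -
  let ?\<sigma> = "inv \<pi>"
  have \<sigma>: "?\<sigma> permutes {1..N}" by (rule permutes_inv[OF \<pi>])
  have in_S: "?\<sigma> i \<in> {1..N}" if "i \<in> {1..N}" for i
    using that permutes_in_image[OF \<sigma>] by blast
  have chain: "map (\<lambda>i. w ! (?\<sigma> i - 1)) [1..<Suc N]
      \<in> chains N (\<lambda>i. if \<omega> (?\<sigma> (Suc i)) < \<omega> (?\<sigma> i) then 1 else 0) \<longleftrightarrow>
    (\<forall>i. 1 \<le> i \<and> i < N \<longrightarrow> precedes \<omega> w (?\<sigma> i) (?\<sigma> (Suc i)))" (is "_ \<longleftrightarrow> ?steps")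
  proof -
    have "precedes \<omega> w (?\<sigma> (Suc i)) (?\<sigma> (Suc (Suc i))) \<longleftrightarrow>
        w ! (?\<sigma> (Suc (Suc i)) - 1) + (if \<omega> (?\<sigma> (Suc (Suc i))) < \<omega> (?\<sigma> (Suc i)) then 1 else 0)
          \<le> w ! (?\<sigma> (Suc i) - 1)" if "Suc i < N" for i
    proof -
      have "?\<sigma> (Suc i) \<noteq> ?\<sigma> (Suc (Suc i))" by (simp add: inj_eq[OF permutes_inj[OF \<sigma>]])
      then have "\<omega> (?\<sigma> (Suc i)) \<noteq> \<omega> (?\<sigma> (Suc (Suc i)))"
        using inj_onD[OF inj, of "?\<sigma> (Suc i)" "?\<sigma> (Suc (Suc i))"] in_S[of "Suc i"] in_S[of "Suc (Suc i)"] that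
        by auto
      then show ?thesis by (auto simp: precedes_def)
    qed
    then have "(\<forall>i. Suc i < N \<longrightarrow> precedes \<omega> w (?\<sigma> (Suc i)) (?\<sigma> (Suc (Suc i)))) \<longleftrightarrow>
      map (\<lambda>i. w ! (?\<sigma> i - 1)) [1..<Suc N]
      \<in> chains N (\<lambda>i. if \<omega> (?\<sigma> (Suc i)) < \<omega> (?\<sigma> i) then 1 else 0)"
      by (simp add: chains_def del: upt_Suc)
    moreover have "?steps \<longleftrightarrow> (\<forall>i. Suc i < N \<longrightarrow> precedes \<omega> w (?\<sigma> (Suc i)) (?\<sigma> (Suc (Suc i))))"
    proof (intro iffI allI impI)
      fix i assume *: "\<forall>i. Suc i < N \<longrightarrow> precedes \<omega> w (?\<sigma> (Suc i)) (?\<sigma> (Suc (Suc i)))" "1 \<le> i \<and> i < N"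
      then show "precedes \<omega> w (?\<sigma> i) (?\<sigma> (Suc i))" by (cases i) auto
    qed auto
    ultimately show ?thesis by blast
  qed
  have "ranks \<omega> w \<pi> \<longleftrightarrow> (\<forall>i\<in>{1..N}. \<forall>j\<in>{1..N}. i < j \<longleftrightarrow> precedes \<omega> w (?\<sigma> i) (?\<sigma> j))"
  proof (rule iffI, intro ballI)
    fix i j assume r: "ranks \<omega> w \<pi>" and ij: "i \<in> {1..N}" "j \<in> {1..N}"
    have "\<pi> (?\<sigma> i) < \<pi> (?\<sigma> j) \<longleftrightarrow> precedes \<omega> w (?\<sigma> i) (?\<sigma> j)"
      using r in_S[OF ij(1)] in_S[OF ij(2)] len unfolding ranks_def by blast
    then show "i < j \<longleftrightarrow> precedes \<omega> w (?\<sigma> i) (?\<sigma> j)" by (simp add: permutes_inverses[OF \<pi>])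
  next
    assume *: "\<forall>i\<in>{1..N}. \<forall>j\<in>{1..N}. i < j \<longleftrightarrow> precedes \<omega> w (?\<sigma> i) (?\<sigma> j)"
    have "\<pi> i < \<pi> j \<longleftrightarrow> precedes \<omega> w i j" if "i \<in> {1..N}" "j \<in> {1..N}" for i j
    proof -
      have "\<pi> i \<in> {1..N}" "\<pi> j \<in> {1..N}" using that permutes_in_image[OF \<pi>] by blast+
      then have "\<pi> i < \<pi> j \<longleftrightarrow> precedes \<omega> w (?\<sigma> (\<pi> i)) (?\<sigma> (\<pi> j))" using * by blast
      then show ?thesis by (simp add: permutes_inverses[OF \<pi>])
    qed
    then show "ranks \<omega> w \<pi>" using \<pi> len by (simp add: ranks_def)
  qed
  also have "\<dots> \<longleftrightarrow> ?steps"
  proof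
    assume steps: ?steps
    have less: "precedes \<omega> w (?\<sigma> i) (?\<sigma> (i + Suc k))" if "1 \<le> i" "i + Suc k \<le> N" for i k
      using that(2)
    proof (induction k)
      case 0
      then show ?case using steps that by simp
    next
      case (Suc k)
      then have "precedes \<omega> w (?\<sigma> (i + Suc k)) (?\<sigma> (Suc (i + Suc k)))" using steps that by simp
      moreover have "precedes \<omega> w (?\<sigma> i) (?\<sigma> (i + Suc k))" using Suc by simp
      ultimately show ?case by (auto intro: precedes_trans)
    qed
    have less: "precedes \<omega> w (?\<sigma> i) (?\<sigma> j)" if "i \<in> {1..N}" "j \<in> {1..N}" "i < j" for i j
      using less[of i "j - i - 1"] that by simp
    show "\<forall>i\<in>{1..N}. \<forall>j\<in>{1..N}. i < j \<longleftrightarrow> precedes \<omega> w (?\<sigma> i) (?\<sigma> j)"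
    proof (intro ballI iffI)
      fix i j assume ij: "i \<in> {1..N}" "j \<in> {1..N}" "precedes \<omega> w (?\<sigma> i) (?\<sigma> j)"
      then show "i < j"
        using less[of j i] precedes_asym by (cases i j rule: linorder_cases) auto
    qed (use less in blast)
  next
    assume *: "\<forall>i\<in>{1..N}. \<forall>j\<in>{1..N}. i < j \<longleftrightarrow> precedes \<omega> w (?\<sigma> i) (?\<sigma> j)"
    show ?steps
    proof (intro allI impI)
      fix i assume "1 \<le> i \<and> i < N"
      then have "i \<in> {1..N}" "Suc i \<in> {1..N}" by auto
      then show "precedes \<omega> w (?\<sigma> i) (?\<sigma> (Suc i))" using * by blast
    qed
  qed
  finally show ?thesis using chain by blast
qed

lemma sum_list_permuted_word:
  assumes "\<sigma> permutes {1..length w}"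
  shows "sum_list (map (\<lambda>i. w ! (\<sigma> i - 1)) [1..<Suc (length w)]) = (sum_list w :: nat)"
proof -
  have "sum_list (map (\<lambda>i. w ! (\<sigma> i - 1)) [1..<Suc (length w)]) = (\<Sum>i\<in>{1..length w}. w ! (\<sigma> i - 1))"
    by (simp only: sum_set_upt_conv_sum_list_nat[symmetric] set_upt atLeastLessThanSuc_atLeastAtMost)
  also have "\<dots> = (\<Sum>i\<in>{1..length w}. w ! (i - 1))"
    using sum.permute[OF assms, of "\<lambda>i. w ! (i - 1)"] by (simp add: o_def)
  also have "\<dots> = (\<Sum>i<length w. w ! i)"
    by (rule sum.reindex_bij_witness[of _ Suc "\<lambda>i. i - 1"]) auto
  finally show ?thesis by (simp add: sum_list_sum_nth lessThan_atLeast0)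
qed

text \<open>Rearranging the letters in sorted order is a bijection onto chains which keeps the sum.
  The jumps of the chain sit at the descents of \<open>\<omega> \<circ> inv \<pi>\<close>, and their
  weighted number is the major index.\<close>

lemma ranks_weight:
  assumes q: "0 < q" "q < 1"
    and \<pi>: "\<pi> permutes {1..N}" and inj: "inj_on \<omega> {1..N}"
  shows "word_weight q {w. length w = N \<and> ranks \<omega> w \<pi>}
    = q ^ maj (perm_word N (\<omega> \<circ> inv \<pi>)) / qpochhammer q q N"
proof -
  let ?\<sigma> = "inv \<pi>"
  let ?d = "\<lambda>i. if \<omega> (?\<sigma> (Suc i)) < \<omega> (?\<sigma> i) then 1 else 0"
  define act where "act \<rho> w = map (\<lambda>i. w ! (\<rho> i - 1)) [1..<Suc N]" for \<rho> and w :: "nat list"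
  have \<sigma>: "?\<sigma> permutes {1..N}" by (rule permutes_inv[OF \<pi>])
  have len: "length (act \<rho> w) = N" for \<rho> w by (simp add: act_def)
  have in_S: "\<rho> (Suc i) - Suc 0 < N" "Suc (\<rho> (Suc i) - Suc 0) = \<rho> (Suc i)"
    "\<rho> (Suc i) \<le> N" if "\<rho> permutes {1..N}" "i < N" for \<rho> i
    using that permutes_in_image[OF that(1), of "Suc i"] by auto
  have act_act: "act \<rho> (act \<tau> w) = w"
    if "\<rho> permutes {1..N}" "\<And>i. \<tau> (\<rho> i) = i" "length w = N" for \<rho> \<tau> w
    by (rule nth_equalityI) (use that in_S[OF that(1)] in \<open>auto simp: act_def less_Suc_eq_le simp del: upt_Suc\<close>)
  have sum_act: "sum_list (act \<rho> w) = sum_list w" if "\<rho> permutes {1..N}" "length w = N" for \<rho> w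
    using sum_list_permuted_word[of \<rho> w] that by (simp add: act_def)
  have "((\<lambda>w. q ^ sum_list w) has_sum q ^ (\<Sum>i\<in>{1..<N}. i * ?d i) / qpochhammer q q N) (chains N ?d)"
    by (rule chains_weight_has_sum[OF q])
  also have "?this \<longleftrightarrow> ((\<lambda>w. q ^ sum_list w) has_sum
      q ^ (\<Sum>i\<in>{1..<N}. i * ?d i) / qpochhammer q q N) {w. length w = N \<and> ranks \<omega> w \<pi>}"
  proof (rule has_sum_reindex_bij_witness[of _ "act ?\<sigma>" "act \<pi>"])
    fix w assume w: "w \<in> chains N ?d"
    then have l: "length w = N" by (simp add: chains_def)
    show eq: "act ?\<sigma> (act \<pi> w) = w"
      by (rule act_act[OF \<sigma>]) (use l permutes_inverses[OF \<pi>] in auto)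
    show "act \<pi> w \<in> {w. length w = N \<and> ranks \<omega> w \<pi>}"
      using ranks_iff_sorted[OF len \<pi> inj, of \<pi> w] eq w by (simp add: len act_def)
    show "q ^ sum_list (act \<pi> w) = q ^ sum_list w" using sum_act[OF \<pi> l] by simp
  next
    fix w assume w: "w \<in> {w. length w = N \<and> ranks \<omega> w \<pi>}"
    show "act \<pi> (act ?\<sigma> w) = w"
      by (rule act_act[OF \<pi>]) (use w permutes_inverses[OF \<pi>] in auto)
    show "act ?\<sigma> w \<in> chains N ?d"
      using ranks_iff_sorted[OF _ \<pi> inj, of w] w by (simp add: act_def)
  qed (rule refl)
  also have "(\<Sum>i\<in>{1..<N}. i * ?d i) = maj (perm_word N (\<omega> \<circ> ?\<sigma>))"
  proof -
    have "maj (perm_word N (\<omega> \<circ> ?\<sigma>)) = \<Sum>{i \<in> {1..<N}. \<omega> (?\<sigma> (Suc i)) < \<omega> (?\<sigma> i)}"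
      unfolding maj_def perm_word_def
      by (intro arg_cong[of _ _ "sum (\<lambda>i. i)"] Collect_cong) (auto simp del: upt_Suc)
    also have "\<dots> = (\<Sum>i\<in>{1..<N}. if \<omega> (?\<sigma> (Suc i)) < \<omega> (?\<sigma> i) then i else 0)"
      by (rule sum.inter_filter) simp
    also have "\<dots> = (\<Sum>i\<in>{1..<N}. i * ?d i)" by (intro sum.cong) auto
    finally show ?thesis ..
  qed
  finally show ?thesis by (rule word_weight_eqI)
qed

text \<open>One name for both kinds of alternating permutations, selected by the direction of the
  first step.\<close>

definition alt_perms :: "bool \<Rightarrow> nat \<Rightarrow> (nat \<Rightarrow> nat) set" where
  "alt_perms up N = {p. p permutes {1..N} \<and>
    alternating (if up then (<) else (>)) (if up then (>) else (<)) (perm_word N p)}"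

lemma Alt_eq_alt_perms: "Alt = alt_perms True" and Ralt_eq_alt_perms: "Ralt = alt_perms False"
  by (auto simp: fun_eq_iff Alt_def Ralt_def alt_perms_def)

text \<open>The hypothesis \<open>rel\<close> says that a link of the word obeys its relation exactly when
  the ranks of its two positions rise or fall as prescribed.  So whether a word alternates depends
  only on its ranking, and the alternating words are a disjoint union of classes of equal
  ranking.\<close>

theorem alt_words_weight_eq_maj:
  assumes q: "0 < q" "q < 1" and inj: "inj_on \<omega> {1..N}"
    and rel: "\<And>i x y. Suc i < N \<Longrightarrow> (if even i then \<alpha> else \<beta>) x y \<longleftrightarrow>
      ((even i = up) = (y < x \<or> x = y \<and> \<omega> (Suc i) < \<omega> (Suc (Suc i))))"
  shows "word_weight q (alt_words \<alpha> \<beta> N) =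
    (\<Sum>\<pi>\<in>alt_perms up N. q ^ maj (perm_word N (\<omega> \<circ> inv \<pi>))) / qpochhammer q q N"
proof -
  have perm: "\<pi> permutes {1..N}" if "\<pi> \<in> alt_perms up N" for \<pi>
    using that by (simp add: alt_perms_def)
  have fin: "finite (alt_perms up N)"
    by (rule finite_subset[OF _ finite_permutations[of "{1..N}"]]) (auto simp: alt_perms_def)
  have iff: "w \<in> alt_words \<alpha> \<beta> N \<longleftrightarrow> \<pi> \<in> alt_perms up N"
    if len: "length w = N" and r: "ranks \<omega> w \<pi>" for w \<pi>
  proof -
    have \<pi>: "\<pi> permutes {1..N}" using r len by (simp add: ranks_def)
    have "(if even i then \<alpha> else \<beta>) (w ! i) (w ! Suc i) \<longleftrightarrow>
        (if even i then if up then (<) else (>) else if up then (>) else (<))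
          (\<pi> (Suc i)) (\<pi> (Suc (Suc i)))" if i: "Suc i < N" for i
    proof -
      have ne: "\<pi> (Suc i) \<noteq> \<pi> (Suc (Suc i))" by (simp add: inj_eq[OF permutes_inj[OF \<pi>]])
      have "precedes \<omega> w (Suc i) (Suc (Suc i)) \<longleftrightarrow> \<pi> (Suc i) < \<pi> (Suc (Suc i))"
        using r len i by (auto simp: ranks_def)
      then show ?thesis using rel[OF i, of "w ! i" "w ! Suc i"] ne by (auto simp: precedes_def)
    qed
    then show ?thesis
      using len \<pi> by (simp add: alt_words_def alt_perms_def alternating_def perm_word_def del: upt_Suc)
  qed
  have "alt_words \<alpha> \<beta> N = (\<Union>\<pi>\<in>alt_perms up N. {w. length w = N \<and> ranks \<omega> w \<pi>})"
  proof (rule set_eqI)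
    fix w
    show "w \<in> alt_words \<alpha> \<beta> N \<longleftrightarrow> w \<in> (\<Union>\<pi>\<in>alt_perms up N. {w. length w = N \<and> ranks \<omega> w \<pi>})"
    proof (cases "length w = N")
      case True
      then obtain \<pi> where "ranks \<omega> w \<pi>" using ranks_exists[of \<omega> w] inj by auto
      then show ?thesis using iff[OF True] True by blast
    next
      case False
      then show ?thesis by (auto simp: alt_words_def)
    qed
  qed
  also have "word_weight q \<dots> = (\<Sum>\<pi>\<in>alt_perms up N. word_weight q {w. length w = N \<and> ranks \<omega> w \<pi>})"
    by (rule word_weight_UN_disjoint[OF q fin, of _ N]) (auto dest: ranks_unique)
  also have "\<dots> = (\<Sum>\<pi>\<in>alt_perms up N. q ^ maj (perm_word N (\<omega> \<circ> inv \<pi>)) / qpochhammer q q N)"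
    by (intro sum.cong refl ranks_weight[OF q perm inj])
  finally show ?thesis by (simp add: sum_divide_distrib)
qed

section \<open>Inversions and ascents of words cut at a maximum\<close>

lemma inv_num_Nil [simp]: "inv_num [] = 0"
  by (simp add: inv_num_def)

lemma inv_num_Cons [simp]: "inv_num (x # w) = length (filter (\<lambda>y. y < x) w) + inv_num w"
proof -
  let ?A = "{j. j < length w \<and> w ! j < x}"
  let ?B = "{(i, j). i < j \<and> j < length w \<and> w ! i > w ! j}"
  have fin: "finite ?B" by (rule finite_subset[of _ "{..<length w} \<times> {..<length w}"]) auto
  have "{(i, j). i < j \<and> j < length (x # w) \<and> (x # w) ! i > (x # w) ! j}
      = (\<lambda>j. (0, Suc j)) ` ?A \<union> map_prod Suc Suc ` ?B" (is "?C = _")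
  proof (rule set_eqI)
    fix p :: "nat \<times> nat"
    obtain i j where "p = (i, j)" by (cases p)
    then show "p \<in> ?C \<longleftrightarrow> p \<in> (\<lambda>j. (0, Suc j)) ` ?A \<union> map_prod Suc Suc ` ?B"
      by (cases i; cases j) (auto simp: image_iff)
  qed
  then have "inv_num (x # w) = card ((\<lambda>j. (0::nat, Suc j)) ` ?A \<union> map_prod Suc Suc ` ?B)"
    by (simp only: inv_num_def)
  also have "\<dots> = card ((\<lambda>j. (0::nat, Suc j)) ` ?A) + card (map_prod Suc Suc ` ?B)"
    by (rule card_Un_disjoint) (use fin in auto)
  also have "card ((\<lambda>j. (0::nat, Suc j)) ` ?A) = card ?A"
    by (rule card_image) (simp add: inj_on_def)
  also have "card (map_prod Suc Suc ` ?B) = card ?B"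
    by (rule card_image) (auto simp: inj_on_def)
  finally show ?thesis by (simp add: length_filter_conv_card inv_num_def)
qed

lemma inv_num_append:
  "inv_num (u @ v) = inv_num u + inv_num v + (\<Sum>x\<leftarrow>u. length (filter (\<lambda>y. y < x) v))"
  by (induction u) auto

lemma asc_Nil [simp]: "asc [] = 0" and asc_single [simp]: "asc [x] = 0"
  by (auto simp: asc_def)

lemma asc_Cons_Cons [simp]: "asc (x # y # w) = (if x < y then 1 else 0) + asc (y # w)"
proof -
  let ?B = "{i \<in> {1..<length (y # w)}. (y # w) ! (i - 1) < (y # w) ! i}"
  have "{i \<in> {1..<length (x # y # w)}. (x # y # w) ! (i - 1) < (x # y # w) ! i}
      = (if x < y then {1} else {}) \<union> Suc ` ?B" (is "?C = _")
  proof (rule set_eqI)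
    fix i
    consider "i = 0" | "i = 1" | j where "i = Suc (Suc j)" by (metis One_nat_def not0_implies_Suc)
    then show "i \<in> ?C \<longleftrightarrow> i \<in> (if x < y then {1} else {}) \<union> Suc ` ?B"
      by cases (auto simp: image_iff)
  qed
  then have "asc (x # y # w) = card ((if x < y then {1} else {}) \<union> Suc ` ?B)"
    by (simp only: asc_def)
  also have "\<dots> = card (if x < y then {1::nat} else {}) + card (Suc ` ?B)"
    by (rule card_Un_disjoint) auto
  also have "card (Suc ` ?B) = card ?B" by (rule card_image) simp
  finally show ?thesis by (simp add: asc_def)
qed

lemma asc_append_max:
  assumes "\<And>x. x \<in> set u \<union> set v \<Longrightarrow> x < m"
  shows "asc (u @ m # v) = asc u + (if u = [] then 0 else 1) + asc v"
proof -
  have v: "asc (m # v) = asc v"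
  proof (cases v)
    case (Cons a v')
    then have "a < m" using assms[of a] by simp
    then show ?thesis using Cons by simp
  qed simp
  show ?thesis
    using assms by (induction u rule: induct_list012) (auto simp: v)
qed

text \<open>The entry \<open>m\<close> is in an even position, counted from 1, and parities start afresh
  behind it.\<close>

lemma even_part_append_odd:
  assumes "odd (length u)"
  shows "even_part (u @ m # v) = even_part u @ m # even_part v"
  using assms by (simp add: even_part_def nths_append nths_Cons)

lemma alternating_simps [simp]:
  "alternating \<alpha> \<beta> []" "alternating \<alpha> \<beta> [x]"
  "alternating \<alpha> \<beta> (x # y # w) \<longleftrightarrow> \<alpha> x y \<and> alternating \<beta> \<alpha> (y # w)"
proof -
  show "alternating \<alpha> \<beta> (x # y # w) \<longleftrightarrow> \<alpha> x y \<and> alternating \<beta> \<alpha> (y # w)"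
    unfolding alternating_def
  proof safe
    assume *: "\<forall>i. Suc i < length (x # y # w) \<longrightarrow>
      (if even i then \<alpha> else \<beta>) ((x # y # w) ! i) ((x # y # w) ! Suc i)"
    show "\<alpha> x y" using *[rule_format, of 0] by simp
    fix i assume "Suc i < length (y # w)"
    then show "(if even i then \<beta> else \<alpha>) ((y # w) ! i) ((y # w) ! Suc i)"
      using *[rule_format, of "Suc i"] by (auto split: if_splits)
  next
    fix i assume "\<alpha> x y" "\<forall>i. Suc i < length (y # w) \<longrightarrow>
      (if even i then \<beta> else \<alpha>) ((y # w) ! i) ((y # w) ! Suc i)" "Suc i < length (x # y # w)"
    then show "(if even i then \<alpha> else \<beta>) ((x # y # w) ! i) ((x # y # w) ! Suc i)"
      by (cases i) (auto split: if_splits)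
  qed
qed (auto simp: alternating_def)

text \<open>The maximum can only stand at a peak.  The second alternative of the first equivalence is
  the word consisting of the maximum alone, which has no neighbours to compare with.\<close>

lemma alternating_append_max:
  assumes "\<And>x. x \<in> set u \<union> set v \<Longrightarrow> x < m"
  shows "alternating (<) (>) (u @ m # v) \<longleftrightarrow>
      odd (length u) \<and> alternating (<) (>) u \<and> alternating (<) (>) v \<or> u = [] \<and> v = []"
    and "alternating (>) (<) (u @ m # v) \<longleftrightarrow>
      even (length u) \<and> alternating (>) (<) u \<and> alternating (<) (>) v"
proof -
  have up: "alternating (<) (>) (m # v) \<longleftrightarrow> v = []"
    and down: "alternating (>) (<) (m # v) \<longleftrightarrow> alternating (<) (>) v"
    using assms by (cases v; force)+
  have "(alternating (<) (>) (u @ m # v) \<longleftrightarrow>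
      odd (length u) \<and> alternating (<) (>) u \<and> alternating (<) (>) v \<or> u = [] \<and> v = []) \<and>
    (alternating (>) (<) (u @ m # v) \<longleftrightarrow>
      even (length u) \<and> alternating (>) (<) u \<and> alternating (<) (>) v)"
    using assms
  proof (induction u)
    case Nil
    then show ?case by (simp add: up down)
  next
    case (Cons x u)
    have x: "x < m" using Cons.prems[of x] by simp
    show ?case
    proof (cases u)
      case Nil
      then show ?thesis using x by (simp add: up down)
    next
      case (Cons y u')
      then show ?thesis using Cons.IH Cons.prems by auto
    qed
  qed
  then show "alternating (<) (>) (u @ m # v) \<longleftrightarrow>
      odd (length u) \<and> alternating (<) (>) u \<and> alternating (<) (>) v \<or> u = [] \<and> v = []"
    "alternating (>) (<) (u @ m # v) \<longleftrightarrow>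
      even (length u) \<and> alternating (>) (<) u \<and> alternating (<) (>) v"
    by blast+
qed

text \<open>The number of inversions between a word with letters \<open>B\<close> and a word with letters
  \<open>C\<close> that follows it.\<close>

definition cross :: "nat set \<Rightarrow> nat set \<Rightarrow> nat" where
  "cross B C = (\<Sum>x\<in>B. card {y \<in> C. y < x})"

lemma inv_num_append_max:
  assumes "distinct u" "distinct v" and "\<And>x. x \<in> set u \<union> set v \<Longrightarrow> x < m"
  shows "inv_num (u @ m # v) = inv_num u + inv_num v + length v + cross (set u) (set v)"
proof -
  have "filter (\<lambda>y. y < m) v = v" using assms by (simp add: filter_id_conv)
  moreover have "(\<Sum>x\<leftarrow>u. length (filter (\<lambda>y. y < x) (m # v))) = cross (set u) (set v)"
  proof -
    have "(\<Sum>x\<leftarrow>u. length (filter (\<lambda>y. y < x) (m # v))) = (\<Sum>x\<leftarrow>u. card {y \<in> set v. y < x})"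
      using assms
      by (intro arg_cong[of _ _ sum_list] map_cong refl)
        (auto simp: distinct_length_filter Int_def conj_commute dest: less_asym)
    then show ?thesis using assms by (simp add: cross_def sum_list_distinct_conv_sum_set)
  qed
  ultimately show ?thesis by (simp add: inv_num_append)
qed

section \<open>The q-binomial theorem for cross inversions\<close>

lemma qpochhammer_Suc: "qpochhammer q q (Suc n) = qpochhammer q q n * (1 - q ^ Suc n)"
  by (simp add: qpochhammer_def)

lemma qpochhammer_0 [simp]: "qpochhammer q q 0 = 1"
  by (simp add: qpochhammer_def)

text \<open>The least element \<open>m\<close> either is put into \<open>B\<close>, where it is in no inversion, or
  into the complement, where it is inverted with all elements of \<open>B\<close>.  This is Pascal's rule
  for \<open>q\<close>-binomial coefficients.\<close>

theorem sum_power_cross: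
  assumes q: "0 < q" "q \<noteq> 1" and "finite A"
  shows "(\<Sum>B | B \<subseteq> A \<and> card B = b. q ^ cross B (A - B)) =
    (if b \<le> card A then qpochhammer q q (card A) / (qpochhammer q q b * qpochhammer q q (card A - b)) else 0)"
  using \<open>finite A\<close>
proof (induction A arbitrary: b rule: finite_linorder_min_induct)
  case empty
  have "{B :: nat set. B = {} \<and> card B = b} = (if b = 0 then {{}} else {})" for b by auto
  then show ?case by (simp add: cross_def)
next
  case (insert m A)
  note Q0 = qpochhammer_nonzero[OF q]
  have m: "m \<notin> A" using insert by auto
  let ?S = "\<lambda>b. {B. B \<subseteq> A \<and> card B = b}"
  have fin: "finite B" if "B \<subseteq> A" for B using that insert.hyps finite_subset by blast
  have finS: "finite (?S b)" for b
    by (rule finite_subset[of _ "Pow A"]) (use insert.hyps in auto)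
  have without: "q ^ cross B (insert m A - B) = q ^ b * q ^ cross B (A - B)" if B: "B \<in> ?S b" for B
  proof -
    have "cross B (insert m A - B) = (\<Sum>x\<in>B. Suc (card {y \<in> A - B. y < x}))"
      unfolding cross_def
    proof (rule sum.cong)
      fix x assume x: "x \<in> B"
      then have "{y \<in> insert m A - B. y < x} = insert m {y \<in> A - B. y < x}"
        using B insert m by auto
      then show "card {y \<in> insert m A - B. y < x} = Suc (card {y \<in> A - B. y < x})"
        using m insert.hyps by simp
    qed simp
    also have "\<dots> = b + cross B (A - B)"
      using B by (simp add: cross_def sum_Suc)
    finally show ?thesis by (simp add: power_add)
  qed
  have with_m: "q ^ cross (insert m B) (insert m A - insert m B) = q ^ cross B (A - B)" if B: "B \<subseteq> A" for B
  proof -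
    have "insert m A - insert m B = A - B" "m \<notin> B" using m B by auto
    then have "cross (insert m B) (insert m A - insert m B) = card {y \<in> A - B. y < m} + cross B (A - B)"
      using fin[OF B] by (simp only: cross_def sum.insert simp_thms)
    also have "{y \<in> A - B. y < m} = {}" using insert.hyps by auto
    finally show ?thesis by simp
  qed
  have split: "{B. B \<subseteq> insert m A \<and> card B = b} =
      ?S b \<union> (if b = 0 then {} else insert m ` ?S (b - 1))" (is "?L = ?R")
  proof
    show "?R \<subseteq> ?L" using m fin by (auto simp: card_insert_if split: if_splits)
    show "?L \<subseteq> ?R"
    proof
      fix B assume B: "B \<in> ?L"
      show "B \<in> ?R"
      proof (cases "m \<in> B")
        case True
        then obtain B' where B': "B = insert m B'" "m \<notin> B'" by (meson mk_disjoint_insert)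
        then have "B' \<subseteq> A" using B by auto
        then have "b \<noteq> 0" "B' \<in> ?S (b - 1)" using B B' fin[of B'] by auto
        then show ?thesis using B' by auto
      qed (use B in auto)
    qed
  qed
  have "(\<Sum>B | B \<subseteq> insert m A \<and> card B = b. q ^ cross B (insert m A - B)) =
      (\<Sum>B\<in>?S b. q ^ cross B (insert m A - B)) +
      (\<Sum>B\<in>(if b = 0 then {} else insert m ` ?S (b - 1)). q ^ cross B (insert m A - B))"
    unfolding split by (rule sum.union_disjoint) (use finS m in auto)
  also have "(\<Sum>B\<in>?S b. q ^ cross B (insert m A - B)) = q ^ b * (\<Sum>B\<in>?S b. q ^ cross B (A - B))"
    unfolding sum_distrib_left by (rule sum.cong[OF refl without])
  also have "(\<Sum>B\<in>(if b = 0 then {} else insert m ` ?S (b - 1)). q ^ cross B (insert m A - B)) =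
      (if b = 0 then 0 else (\<Sum>B\<in>?S (b - 1). q ^ cross B (A - B)))"
  proof (cases "b = 0")
    case False
    have "inj_on (insert m) (?S (b - 1))" using m by (auto simp: inj_on_def insert_ident)
    then show ?thesis using False with_m by (simp add: sum.reindex)
  qed simp
  finally have eq: "(\<Sum>B | B \<subseteq> insert m A \<and> card B = b. q ^ cross B (insert m A - B)) =
    q ^ b * (\<Sum>B\<in>?S b. q ^ cross B (A - B)) + (if b = 0 then 0 else (\<Sum>B\<in>?S (b - 1). q ^ cross B (A - B)))" .
  have card: "card (insert m A) = Suc (card A)" using m insert.hyps by simp
  consider "b = 0" | "0 < b" "b \<le> card A" | "b = Suc (card A)" | "b > Suc (card A)" by linarith
  then show ?case
  proof cases
    case 2
    obtain k where k: "b = Suc k" using 2 by (cases b) auto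
    obtain l where l: "card A = b + l" using 2 le_Suc_ex by blast
    have "1 - q ^ Suc k \<noteq> 0" "1 - q ^ Suc l \<noteq> 0"
      using Q0[of "Suc k"] Q0[of "Suc l"] by (auto simp: qpochhammer_Suc)
    moreover have "1 - q ^ Suc (Suc (k + l)) = (1 - q ^ Suc k) + q ^ Suc k * (1 - q ^ Suc l)"
      by (simp add: algebra_simps power_add)
    ultimately show ?thesis
      unfolding eq insert.IH card
      using Q0[of k] Q0[of l] k l
      by (simp add: qpochhammer_Suc Suc_diff_le divide_simps) (simp add: algebra_simps power_add)
  qed (unfold eq insert.IH card, use Q0 in simp_all)
qed

section \<open>Splitting alternating permutations at the maximum\<close>

text \<open>Permutations are taken as lists over an arbitrary finite set of numbers.  The two pieces
  of a cut permutation are then objects of the same kind, with no renumbering.\<close>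

definition alt_lists :: "nat set \<Rightarrow> nat list set" where
  "alt_lists A = {w \<in> permutations_of_set A. alternating (<) (>) w}"

definition inv_weight :: "real \<Rightarrow> real \<Rightarrow> nat list \<Rightarrow> real" where
  "inv_weight q t w = q ^ inv_num w * t ^ asc (even_part w)"

definition inv_gf :: "real \<Rightarrow> real \<Rightarrow> nat set \<Rightarrow> real" where
  "inv_gf q t A = (\<Sum>w\<in>alt_lists A. inv_weight q t w)"

lemma finite_alt_lists: "finite (alt_lists A)"
  by (simp add: alt_lists_def)

lemma alt_listsD:
  assumes "w \<in> alt_lists A"
  shows "set w = A" "distinct w" "length w = card A" "alternating (<) (>) w"
  using assms by (auto simp: alt_lists_def permutations_of_set_def distinct_card)

lemma even_part_eq_Nil_iff: "even_part w = [] \<longleftrightarrow> length w < 2"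
proof -
  have "even_part (x # y # w') = y # even_part w'" for x y :: nat and w'
    by (simp add: even_part_def nths_Cons)
  then show ?thesis by (induction w rule: induct_list012) (auto simp: even_part_def nths_Cons)
qed

text \<open>The maximum stands in an even position, so the left piece has odd length.  The maximum is
  inverted with the whole right piece.  In the subword of even positions it ends an ascent, unless
  the left piece contributes nothing there, that is, unless that piece has a single letter; the
  step behind the maximum is a descent.\<close>

lemma inv_gf_split_max:
  assumes A: "finite A" "2 \<le> card A"
  defines "A' \<equiv> A - {Max A}"
  shows "inv_gf q t A = (\<Sum>B | B \<subseteq> A' \<and> odd (card B).
    q ^ cross B (A' - B) * q ^ card (A' - B) * (if 3 \<le> card B then t else 1) * inv_gf q t B * inv_gf q t (A' - B))"
proof -
  let ?m = "Max A"
  have ne: "A \<noteq> {}" using A by auto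
  have m: "?m \<in> A" "\<And>x. x \<in> A' \<Longrightarrow> x < ?m"
    using A ne by (auto simp: A'_def less_le)
  have finA': "finite A'" using A by (simp add: A'_def)
  let ?I = "{B. B \<subseteq> A' \<and> odd (card B)}"
  let ?X = "SIGMA B:?I. alt_lists B \<times> alt_lists (A' - B)"
  have finI: "finite ?I" by (rule finite_subset[of _ "Pow A'"]) (use finA' in auto)
  have product: "(\<Sum>(u, v)\<in>X \<times> Y. c * inv_weight q t u * inv_weight q t v) =
      c * (\<Sum>u\<in>X. inv_weight q t u) * (\<Sum>v\<in>Y. inv_weight q t v)" for c X Y
  proof -
    have "(\<Sum>(u, v)\<in>X \<times> Y. c * inv_weight q t u * inv_weight q t v) =
        c * (\<Sum>(u, v)\<in>X \<times> Y. inv_weight q t u * inv_weight q t v)"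
      by (simp add: sum_distrib_left split_def mult.assoc)
    then show ?thesis by (simp only: sum_product sum.cartesian_product mult.assoc)
  qed
  have "inv_gf q t A = (\<Sum>(B, u, v)\<in>?X.
      q ^ cross B (A' - B) * q ^ card (A' - B) * (if 3 \<le> card B then t else 1) * inv_weight q t u * inv_weight q t v)"
    unfolding inv_gf_def
  proof (rule sum.reindex_bij_witness[of _ "\<lambda>(B, u, v). u @ ?m # v"
        "\<lambda>w. (set (takeWhile (\<lambda>x. x \<noteq> ?m) w), takeWhile (\<lambda>x. x \<noteq> ?m) w, tl (dropWhile (\<lambda>x. x \<noteq> ?m) w))"])
    fix w assume w: "w \<in> alt_lists A"
    then have "?m \<in> set w" using alt_listsD m by blast
    then obtain u v where uv: "w = u @ ?m # v" "?m \<notin> set u" by (metis split_list_first)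
    have take: "takeWhile (\<lambda>x. x \<noteq> ?m) w = u" and drop: "tl (dropWhile (\<lambda>x. x \<noteq> ?m) w) = v"
      using uv by (auto simp: takeWhile_append dropWhile_append)
    have d: "distinct u" "distinct v" "set u \<inter> set v = {}" "?m \<notin> set v" and s: "set u \<union> set v = A'"
      using alt_listsD[OF w] uv by (auto simp: A'_def)
    have less: "x < ?m" if "x \<in> set u \<union> set v" for x using that s m by auto
    have "\<not> (u = [] \<and> v = [])" using alt_listsD(3)[OF w] A uv by auto
    then have alt: "odd (length u)" "alternating (<) (>) u" "alternating (<) (>) v"
      using alt_listsD(4)[OF w] alternating_append_max(1)[OF less] uv by auto
    have v: "set v = A' - set u" using s d by auto
    show "(case (set (takeWhile (\<lambda>x. x \<noteq> ?m) w), takeWhile (\<lambda>x. x \<noteq> ?m) w, tl (dropWhile (\<lambda>x. x \<noteq> ?m) w)) of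
        (B, u, v) \<Rightarrow> u @ ?m # v) = w"
      by (simp only: take drop prod.case uv(1)[symmetric])
    show "(set (takeWhile (\<lambda>x. x \<noteq> ?m) w), takeWhile (\<lambda>x. x \<noteq> ?m) w, tl (dropWhile (\<lambda>x. x \<noteq> ?m) w)) \<in> ?X"
      using alt d s v by (auto simp: take drop alt_lists_def permutations_of_set_def distinct_card)
    have "inv_num w = inv_num u + inv_num v + card (A' - set u) + cross (set u) (A' - set u)"
      using inv_num_append_max[OF d(1,2) less] uv(1) d(2) by (simp only: v[symmetric] distinct_card)
    moreover have "asc (even_part w) = asc (even_part u) + (if 3 \<le> length u then 1 else 0) + asc (even_part v)"
    proof -
      have "asc (even_part w) = asc (even_part u) + (if even_part u = [] then 0 else 1) + asc (even_part v)"
        unfolding uv(1) even_part_append_odd[OF alt(1)]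
        by (rule asc_append_max) (use less in \<open>auto simp: even_part_def dest: in_set_nthsD\<close>)
      moreover have "3 \<le> length u \<longleftrightarrow> \<not> length u < 2" using alt(1) by presburger
      ultimately show ?thesis by (simp add: even_part_eq_Nil_iff)
    qed
    ultimately show "(case (set (takeWhile (\<lambda>x. x \<noteq> ?m) w), takeWhile (\<lambda>x. x \<noteq> ?m) w, tl (dropWhile (\<lambda>x. x \<noteq> ?m) w)) of
        (B, u, v) \<Rightarrow> q ^ cross B (A' - B) * q ^ card (A' - B) * (if 3 \<le> card B then t else 1)
          * inv_weight q t u * inv_weight q t v) = inv_weight q t w"
      using d(1) by (simp add: take drop inv_weight_def power_add distinct_card)
  next
    fix p assume "p \<in> ?X"
    then obtain B u v where p: "p = (B, u, v)" and B: "B \<subseteq> A'" "odd (card B)"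
      and u: "u \<in> alt_lists B" and v: "v \<in> alt_lists (A' - B)" by auto
    have less: "x < ?m" if "x \<in> set u \<union> set v" for x
      using that m alt_listsD(1)[OF u] alt_listsD(1)[OF v] B by auto
    have mu: "?m \<notin> set u" using less by auto
    show "(case (case p of (B, u, v) \<Rightarrow> u @ ?m # v) of w \<Rightarrow>
        (set (takeWhile (\<lambda>x. x \<noteq> ?m) w), takeWhile (\<lambda>x. x \<noteq> ?m) w, tl (dropWhile (\<lambda>x. x \<noteq> ?m) w))) = p"
      using mu alt_listsD(1)[OF u] by (auto simp: p takeWhile_append dropWhile_append)
    have "alternating (<) (>) (u @ ?m # v)"
      by (subst alternating_append_max(1)[of u v ?m])
        (use less alt_listsD[OF u] alt_listsD[OF v] B in auto)
    moreover have "A = insert ?m A'" using m by (auto simp: A'_def)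
    ultimately show "(case p of (B, u, v) \<Rightarrow> u @ ?m # v) \<in> alt_lists A"
      using alt_listsD[OF u] alt_listsD[OF v] B mu less
      by (auto simp: p alt_lists_def permutations_of_set_def)
  qed
  also have "\<dots> = (\<Sum>B\<in>?I. \<Sum>(u, v)\<in>alt_lists B \<times> alt_lists (A' - B).
      q ^ cross B (A' - B) * q ^ card (A' - B) * (if 3 \<le> card B then t else 1) * inv_weight q t u * inv_weight q t v)"
    by (subst sum.Sigma[symmetric]) (use finI finite_alt_lists in auto)
  also have "\<dots> = (\<Sum>B\<in>?I. q ^ cross B (A' - B) * q ^ card (A' - B) * (if 3 \<le> card B then t else 1)
      * inv_gf q t B * inv_gf q t (A' - B))"
    by (simp only: product inv_gf_def)
  finally show ?thesis .
qed

text \<open>Induction on the size with the split at the maximum: the sum over all sets \<open>B\<close> of a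
  given size \<open>k\<close> contributes a \<open>q\<close>-binomial coefficient, which converts the product of the two
  \<open>q\<close>-factorials into one.\<close>

theorem inv_gf_eq:
  assumes q: "0 < q" "q \<noteq> 1"
    and g0: "g 0 = 1" and g1: "g 1 = 1 / (1 - q)"
    and rec: "\<And>N. 2 \<le> N \<Longrightarrow> (1 - q ^ N) * g N =
      (\<Sum>k | k \<le> N - 1 \<and> odd k. (if 3 \<le> k then t else 1) * g k * (q ^ (N - 1 - k) * g (N - 1 - k)))"
    and "finite A"
  shows "inv_gf q t A = qpochhammer q q (card A) * g (card A)"
  using \<open>finite A\<close>
proof (induction "card A" arbitrary: A rule: less_induct)
  case less
  note Q0 = qpochhammer_nonzero[OF q]
  consider "card A = 0" | "card A = 1" | "2 \<le> card A" by linarith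
  then show ?case
  proof cases
    case 1
    then have "alt_lists A = {[]}" using less.prems by (auto simp: alt_lists_def)
    then show ?thesis using 1 by (simp add: inv_gf_def g0 inv_weight_def even_part_def)
  next
    case 2
    then obtain x where "A = {x}" by (auto simp: card_1_singleton_iff)
    then have "alt_lists A = {[x]}" by (auto simp: alt_lists_def)
    then show ?thesis using 2 q g1
      by (simp add: inv_gf_def inv_weight_def even_part_def nths_Cons qpochhammer_def)
  next
    case 3
    define N where "N = card A"
    define A' where "A' = A - {Max A}"
    have "A \<noteq> {}" using 3 by auto
    then have A': "finite A'" "card A' = N - 1" "N - 1 < N"
      using 3 less.prems by (auto simp: A'_def N_def card_Diff_singleton_if Max_in card_gt_0_iff)
    let ?I = "{B. B \<subseteq> A' \<and> odd (card B)}"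
    let ?h = "\<lambda>k. (if 3 \<le> k then t else 1) * g k * (q ^ (N - 1 - k) * g (N - 1 - k))"
    have weight: "q ^ cross B (A' - B) * q ^ card (A' - B) * (if 3 \<le> card B then t else 1)
        * inv_gf q t B * inv_gf q t (A' - B)
      = q ^ cross B (A' - B) * (qpochhammer q q k * qpochhammer q q (N - 1 - k) * ?h k)"
      if B: "B \<subseteq> A'" "card B = k" for B k
    proof -
      have f: "finite B" "finite (A' - B)" using A' B finite_subset by auto
      have c: "card (A' - B) = N - 1 - k" using A' B f by (simp add: card_Diff_subset)
      have "k < N" using B A' card_mono[of A' B] by simp
      then have "inv_gf q t B = qpochhammer q q k * g k"
        "inv_gf q t (A' - B) = qpochhammer q q (N - 1 - k) * g (N - 1 - k)"
        using less.hyps[of B] less.hyps[of "A' - B"] f c B A' by (auto simp: N_def)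
      then show ?thesis using c B by simp
    qed
    have "inv_gf q t A = (\<Sum>B\<in>?I. q ^ cross B (A' - B) * q ^ card (A' - B) * (if 3 \<le> card B then t else 1)
        * inv_gf q t B * inv_gf q t (A' - B))"
      unfolding A'_def by (rule inv_gf_split_max[OF less.prems 3])
    also have "\<dots> = (\<Sum>k | k \<le> N - 1 \<and> odd k. \<Sum>B\<in>{B \<in> ?I. card B = k}.
        q ^ cross B (A' - B) * q ^ card (A' - B) * (if 3 \<le> card B then t else 1)
        * inv_gf q t B * inv_gf q t (A' - B))"
    proof (rule sum.group[symmetric])
      show "finite ?I" by (rule finite_subset[of _ "Pow A'"]) (use A' in auto)
      show "card ` ?I \<subseteq> {k. k \<le> N - 1 \<and> odd k}" using A' card_mono by fastforce
    qed simp
    also have "\<dots> = (\<Sum>k | k \<le> N - 1 \<and> odd k. qpochhammer q q (N - 1) * ?h k)"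
    proof (rule sum.cong[OF refl])
      fix k assume k: "k \<in> {k. k \<le> N - 1 \<and> odd k}"
      then have "{B \<in> ?I. card B = k} = {B. B \<subseteq> A' \<and> card B = k}" by auto
      then have "(\<Sum>B\<in>{B \<in> ?I. card B = k}.
          q ^ cross B (A' - B) * q ^ card (A' - B) * (if 3 \<le> card B then t else 1)
          * inv_gf q t B * inv_gf q t (A' - B))
        = (\<Sum>B | B \<subseteq> A' \<and> card B = k. q ^ cross B (A' - B)
            * (qpochhammer q q k * qpochhammer q q (N - 1 - k) * ?h k))"
        using weight by (intro sum.cong) auto
      also have "\<dots> = (\<Sum>B | B \<subseteq> A' \<and> card B = k. q ^ cross B (A' - B))
            * (qpochhammer q q k * qpochhammer q q (N - 1 - k) * ?h k)"
        by (simp only: sum_distrib_right)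
      also have "\<dots> = qpochhammer q q (N - 1) * ?h k"
        using k Q0 A' by (subst sum_power_cross[OF q A'(1)]) auto
      finally show "(\<Sum>B\<in>{B \<in> ?I. card B = k}.
          q ^ cross B (A' - B) * q ^ card (A' - B) * (if 3 \<le> card B then t else 1)
          * inv_gf q t B * inv_gf q t (A' - B)) = qpochhammer q q (N - 1) * ?h k" .
    qed
    also have "\<dots> = qpochhammer q q (N - 1) * ((1 - q ^ N) * g N)"
      using 3 by (subst rec) (simp_all add: N_def sum_distrib_left)
    also have "\<dots> = qpochhammer q q N * g N"
      using 3 qpochhammer_Suc[of q "N - 1"] by (simp add: N_def)
    finally show ?thesis by (simp add: N_def)
  qed
qed

section \<open>The q-secant and q-tangent series\<close>

lemma even_fps_eq_compose: "even_fps a = Abs_fps a oo fps_X ^ 2"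
proof (rule fps_ext)
  fix n
  have "(Abs_fps a oo fps_X ^ 2) $ n = (\<Sum>i = 0..n. a i * (if n = 2 * i then 1 else 0))"
    by (simp add: fps_compose_nth power_mult[symmetric] fps_X_power_nth)
  also have "\<dots> = (\<Sum>i = 0..n. if even n \<and> i = n div 2 then a i else 0)"
    by (intro sum.cong) auto
  also have "\<dots> = (if even n then a (n div 2) else 0)"
    by auto
  finally show "even_fps a $ n = (Abs_fps a oo fps_X ^ 2) $ n" by (simp add: even_fps_def)
qed

lemma even_fps_inverse:
  assumes "c 0 \<noteq> (0 :: real)"
  shows "inverse (even_fps c) = even_fps (\<lambda>n. inverse (Abs_fps c) $ n)"
proof -
  have "inverse (even_fps c) = inverse (Abs_fps c) oo fps_X ^ 2"
    unfolding even_fps_eq_compose using assms by (intro fps_inverse_compose[symmetric]) auto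
  then show ?thesis by (simp add: even_fps_eq_compose fps_nth_inverse)
qed

text \<open>Write \<open>C\<close> and \<open>S\<close> for the even and odd series with coefficients
  \<open>c\<close> and \<open>s\<close>.  The two hypotheses are the coefficient forms of
  \<open>C(qx) - C(x) = x (t S(x) + (1 - t)/(1 - q) x C(x))\<close> and
  \<open>S(x) - S(qx) = x C(x)\<close>, which deform the derivatives of cosine and sine.  With
  \<open>P = t S/C + (1 - t)/(1 - q) x\<close> they imply \<open>G(x) - G(qx) = x (1 + P(x) G(qx))\<close> for
  \<open>G = (1 + S)/C\<close>.  The correction in \<open>P\<close> restores the weight 1 instead of \<open>t\<close>
  for left pieces with a single letter.\<close>

theorem secant_tangent_recurrence:
  fixes q t :: real and c s :: "nat \<Rightarrow> real"
  assumes q: "0 < q" "q \<noteq> 1" and c0: "c 0 = 1"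
    and H1: "\<And>n. (q ^ (2 * n + 2) - 1) * c (Suc n) = t * s n + (1 - t) / (1 - q) * c n"
    and H2: "\<And>n. (1 - q ^ (2 * n + 1)) * s n = c n"
  defines "F \<equiv> inverse (even_fps c)"
  defines "T \<equiv> fps_X * even_fps s * F"
  defines "G \<equiv> F + T"
  shows "G $ 0 = 1" and "G $ 1 = 1 / (1 - q)" and "G $ (2 * n) = inverse (Abs_fps c) $ n"
    and "2 \<le> N \<Longrightarrow> (1 - q ^ N) * G $ N = (\<Sum>k | k \<le> N - 1 \<and> odd k.
      (if 3 \<le> k then t else 1) * G $ k * (q ^ (N - 1 - k) * G $ (N - 1 - k)))"
proof -
  let ?C = "even_fps c" and ?S = "fps_X * even_fps s"
  let ?sh = "\<lambda>A :: real fps. A oo (fps_const q * fps_X)"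
  define u where "u = (1 - t) / (1 - q)"
  define P where "P = fps_const t * T + fps_const u * fps_X"
  have q1: "1 - q \<noteq> 0" using q by simp
  have C0: "?C $ 0 = 1" by (simp add: even_fps_def c0)
  have CF: "?C * F = 1" unfolding F_def by (rule inverse_mult_eq_1') (simp add: C0)
  have F_even: "F = even_fps (\<lambda>n. inverse (Abs_fps c) $ n)"
    unfolding F_def by (rule even_fps_inverse) (simp add: c0)
  have T_even: "T = fps_X * even_fps (\<lambda>n. (Abs_fps s * inverse (Abs_fps c)) $ n)"
    unfolding T_def F_even even_fps_eq_compose
    by (simp add: mult.assoc fps_nth_inverse fps_compose_mult_distrib del: fps_mult_nth)
  have F_odd0: "F $ k = 0" if "odd k" for k using that by (simp add: F_even even_fps_def)
  have T_even0: "T $ k = 0" if "even k" for k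
    using that by (cases k) (simp_all add: T_even even_fps_def)
  have sh_mult: "?sh (A * B) = ?sh A * ?sh B" for A B by (rule fps_compose_mult_distrib) simp
  have shC: "?sh ?C - ?C = fps_X * (fps_const t * ?S + fps_const u * fps_X * ?C)"
  proof (rule fps_ext)
    fix n :: nat
    consider "n = 0" | "odd n" | m where "n = 2 * m + 2"
    proof (cases "even n")
      case True
      then obtain k where "n = 2 * k" by (rule evenE)
      then show ?thesis using that(1,3) by (cases k) auto
    qed (use that(2) in blast)
    then show "(?sh ?C - ?C) $ n = (fps_X * (fps_const t * ?S + fps_const u * fps_X * ?C)) $ n"
    proof cases
      case (3 m)
      then show ?thesis using H1[of m]
        by (simp add: even_fps_def mult.assoc u_def) (simp add: algebra_simps)
    qed (auto simp: even_fps_def mult.assoc elim!: oddE)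
  qed
  have shS: "?S - ?sh ?S = fps_X * ?C"
  proof (rule fps_ext)
    fix n :: nat
    consider "n = 0" | "even n" "n \<noteq> 0" | m where "n = 2 * m + 1" by (metis oddE)
    then show "(?S - ?sh ?S) $ n = (fps_X * ?C) $ n"
    proof cases
      case (3 m)
      then show ?thesis using H2[of m] by (simp add: even_fps_def) (simp add: algebra_simps)
    qed (auto simp: even_fps_def)
  qed
  have GC: "G * ?C = 1 + ?S" unfolding G_def T_def using CF by (simp add: algebra_simps)
  have shG: "?sh G * ?sh ?C = 1 + ?sh ?S"
    using arg_cong[OF GC, of ?sh] by (simp only: sh_mult fps_compose_add_distrib fps_compose_1)
  have PC: "fps_X * P * ?C = ?sh ?C - ?C"
  proof -
    have "T * ?C = ?S" unfolding T_def using CF by (simp add: algebra_simps)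
    then show ?thesis unfolding shC P_def by (simp add: algebra_simps)
  qed
  \<comment> \<open>Clearing denominators turns the difference equation for G into those for C and S.\<close>
  have "(G - ?sh G) * (?C * ?sh ?C) = (G * ?C) * ?sh ?C - (?sh G * ?sh ?C) * ?C"
    by (simp add: algebra_simps)
  also have "\<dots> = (1 + ?S) * ?sh ?C - (1 + ?sh ?S) * ?C" by (simp only: GC shG)
  also have "\<dots> = (?S - ?sh ?S) * ?sh ?C + (1 + ?sh ?S) * (?sh ?C - ?C)"
    by (simp add: algebra_simps)
  also have "\<dots> = fps_X * ?C * ?sh ?C + (?sh G * ?sh ?C) * (fps_X * P * ?C)"
    by (simp only: shS shG PC)
  also have "\<dots> = (fps_X * (1 + P * ?sh G)) * (?C * ?sh ?C)" by (simp add: algebra_simps)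
  finally have "(G - ?sh G) * (?C * ?sh ?C) = (fps_X * (1 + P * ?sh G)) * (?C * ?sh ?C)" .
  moreover have "?C * ?sh ?C \<noteq> 0"
  proof -
    have "(?C * ?sh ?C) $ 0 = 1" using C0 by (simp add: fps_mult_nth_0)
    then show ?thesis by (metis fps_zero_nth zero_neq_one)
  qed
  ultimately have key: "G - ?sh G = fps_X * (1 + P * ?sh G)" using mult_right_cancel by blast
  show G0: "G $ 0 = 1" by (simp add: G_def T_def F_def C0)
  have T1: "T $ 1 = 1 / (1 - q)"
    using H2[of 0] c0 q1 by (simp add: T_def even_fps_def F_def C0 divide_simps mult.assoc mult.commute)
  then show G1: "G $ 1 = 1 / (1 - q)" by (simp add: G_def F_odd0)
  show "G $ (2 * n) = inverse (Abs_fps c) $ n"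
    using T_even0[of "2 * n"] by (simp add: G_def F_even even_fps_def)
  have P_nth: "P $ k = (if odd k then (if 3 \<le> k then t else 1) * G $ k else 0)" for k
  proof -
    consider "even k" | "k = 1" | "odd k" "3 \<le> k"
    proof -
      have "even k \<or> k = 1 \<or> odd k \<and> 3 \<le> k" by presburger
      then show ?thesis using that by blast
    qed
    then show ?thesis
    proof cases
      case 2
      have "t * (1 / (1 - q)) + u = 1 / (1 - q)" using q1 by (simp add: u_def divide_simps)
      then show ?thesis using 2 T1 G1 by (simp add: P_def)
    next
      case 3
      then show ?thesis by (simp add: P_def G_def F_odd0)
    qed (auto simp: P_def T_even0)
  qed
  show "(1 - q ^ N) * G $ N = (\<Sum>k | k \<le> N - 1 \<and> odd k.
      (if 3 \<le> k then t else 1) * G $ k * (q ^ (N - 1 - k) * G $ (N - 1 - k)))" if N: "2 \<le> N"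
  proof -
    have "(1 - q ^ N) * G $ N = (G - ?sh G) $ N" by (simp add: left_diff_distrib)
    also have "\<dots> = (P * ?sh G) $ (N - 1)" unfolding key using N by simp
    also have "\<dots> = (\<Sum>k\<in>{0..N - 1}. P $ k * (q ^ (N - 1 - k) * G $ (N - 1 - k)))"
      by (simp add: fps_mult_nth)
    also have "\<dots> = (\<Sum>k\<in>{0..N - 1}. if odd k then
        (if 3 \<le> k then t else 1) * G $ k * (q ^ (N - 1 - k) * G $ (N - 1 - k)) else 0)"
      by (intro sum.cong) (auto simp: P_nth)
    also have "\<dots> = (\<Sum>k | k \<in> {0..N - 1} \<and> odd k.
        (if 3 \<le> k then t else 1) * G $ k * (q ^ (N - 1 - k) * G $ (N - 1 - k)))"
      by (rule sum.inter_filter[symmetric]) simp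
    finally show ?thesis by simp
  qed
qed

section \<open>Symmetries of alternating permutations\<close>

lemma perm_word_bij: "bij_betw (perm_word N) {p. p permutes {1..N}} (permutations_of_set {1..N})"
proof -
  have inj: "inj_on (perm_word N) {p. p permutes {1..N}}"
  proof (rule inj_onI, rule ext)
    fix p p' k
    assume *: "p \<in> {p. p permutes {1..N}}" "p' \<in> {p. p permutes {1..N}}" "perm_word N p = perm_word N p'"
    show "p k = p' k"
    proof (cases "k \<in> {1..N}")
      case True
      then show ?thesis using *(3) by (auto simp: perm_word_def map_eq_conv simp del: upt_Suc)
    next
      case False
      then show ?thesis using * by (metis mem_Collect_eq permutes_not_in)
    qed
  qed
  have "perm_word N p \<in> permutations_of_set {1..N}" if "p permutes {1..N}" for p
  proof
    show "set (perm_word N p) = {1..N}"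
      using permutes_image[OF that]
      by (simp add: perm_word_def atLeastLessThanSuc_atLeastAtMost del: upt_Suc)
    show "distinct (perm_word N p)"
      using permutes_inj_on[OF that] by (simp add: perm_word_def distinct_map del: upt_Suc)
  qed
  then have "perm_word N ` {p. p permutes {1..N}} \<subseteq> permutations_of_set {1..N}" by auto
  moreover have "card (perm_word N ` {p. p permutes {1..N}}) = card (permutations_of_set {1..N})"
    using card_image[OF inj] card_permutations[of "{1..N}" N] by simp
  ultimately have "perm_word N ` {p. p permutes {1..N}} = permutations_of_set {1..N}"
    by (intro card_subset_eq) auto
  then show ?thesis using inj by (simp add: bij_betw_def)
qed

lemma sum_perm_word:
  "(\<Sum>p | p permutes {1..N} \<and> P (perm_word N p). h (perm_word N p)) =
    (\<Sum>w | w \<in> permutations_of_set {1..N} \<and> P w. h w)"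
proof -
  have "inj_on (perm_word N) {p. p permutes {1..N} \<and> P (perm_word N p)}"
    using perm_word_bij by (auto simp: bij_betw_def intro: inj_on_subset)
  moreover have "perm_word N ` {p. p permutes {1..N} \<and> P (perm_word N p)} =
      {w \<in> permutations_of_set {1..N}. P w}"
    using perm_word_bij[of N] by (auto simp: bij_betw_def)
  ultimately show ?thesis by (metis (no_types, lifting) sum.reindex_cong)
qed

definition compl :: "nat \<Rightarrow> nat list \<Rightarrow> nat list" where
  "compl N w = map (\<lambda>x. Suc N - x) w"

lemma compl_compl: "set w \<subseteq> {1..N} \<Longrightarrow> compl N (compl N w) = w"
  by (auto simp: compl_def intro!: map_idI)

lemma length_compl [simp]: "length (compl N w) = length w"
  by (simp add: compl_def)

lemma compl_permutation:
  assumes "w \<in> permutations_of_set {1..N}"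
  shows "compl N w \<in> permutations_of_set {1..N}"
proof
  have w: "set w = {1..N}" "distinct w" using assms by (auto simp: permutations_of_set_def)
  have "(\<lambda>x. Suc N - x) ` {1..N} = {1..N}"
  proof safe
    fix x assume "x \<in> {1..N}"
    then show "x \<in> (\<lambda>x. Suc N - x) ` {1..N}" by (intro image_eqI[of _ _ "Suc N - x"]) auto
  qed auto
  then show "set (compl N w) = {1..N}" using w by (simp add: compl_def)
  show "distinct (compl N w)" using w by (auto simp: compl_def distinct_map inj_on_def)
qed

lemma compl_nth:
  assumes "set w \<subseteq> {1..N}" "i < length w" "j < length w"
  shows "compl N w ! i < compl N w ! j \<longleftrightarrow> w ! j < w ! i"
proof -
  have "w ! i \<in> {1..N}" "w ! j \<in> {1..N}" using assms nth_mem by blast+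
  then show ?thesis using assms by (auto simp: compl_def)
qed

lemma alternating_compl:
  assumes "set w \<subseteq> {1..N}"
  shows "alternating (<) (>) (compl N w) \<longleftrightarrow> alternating (>) (<) w"
    and "alternating (>) (<) (compl N w) \<longleftrightarrow> alternating (<) (>) w"
  unfolding alternating_def using compl_nth[OF assms] by (auto split: if_splits)

lemma des_compl: "set w \<subseteq> {1..N} \<Longrightarrow> des (compl N w) = asc w"
  unfolding asc_def des_def by (intro arg_cong[of _ _ card] Collect_cong) (auto simp: compl_nth)

lemma asc_rev: "asc (rev w) = des w"
  unfolding asc_def des_def
  by (rule bij_betw_same_card[of "\<lambda>i. length w - i"],
      rule bij_betw_byWitness[where f' = "\<lambda>i. length w - i"]) (auto simp: rev_nth)

lemma inv_num_compl:
  assumes "distinct w" "set w \<subseteq> {1..N}"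
  shows "2 * (inv_num (compl N w) + inv_num w) = length w * (length w - 1)"
  using assms
proof (induction w)
  case (Cons x w)
  have "Suc N - y < Suc N - x \<longleftrightarrow> \<not> y < x" if "y \<in> set w" for y
  proof -
    have "y \<noteq> x" "y \<in> {1..N}" "x \<in> {1..N}" using Cons.prems that by auto
    then show ?thesis by auto
  qed
  then have "length (filter (\<lambda>y. Suc N - y < Suc N - x) w) = length (filter (\<lambda>y. \<not> y < x) w)"
    by (intro arg_cong[of _ _ length] filter_cong refl) auto
  then have "length (filter (\<lambda>y. y < Suc N - x) (compl N w)) + length (filter (\<lambda>y. y < x) w) = length w"
    using sum_length_filter_compl[of "\<lambda>y. y < x" w] by (simp add: compl_def filter_map o_def)
  then have "2 * (inv_num (compl N (x # w)) + inv_num (x # w)) = 2 * length w + length w * (length w - 1)"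
    using Cons by (simp add: compl_def)
  also have "\<dots> = length (x # w) * (length (x # w) - 1)" by (cases w) auto
  finally show ?case .
qed (simp add: compl_def)

lemma inv_num_rev:
  assumes "distinct w"
  shows "2 * (inv_num (rev w) + inv_num w) = length w * (length w - 1)"
  using assms
proof (induction w)
  case (Cons x w)
  have "(\<Sum>y\<leftarrow>rev w. length (filter (\<lambda>z. z < y) [x])) = length (filter (\<lambda>y. x < y) w)"
    by (induction w) auto
  also have "\<dots> = length (filter (\<lambda>y. \<not> y < x) w)"
  proof -
    have "x < y \<longleftrightarrow> \<not> y < x" if "y \<in> set w" for y
      using Cons.prems that by (cases x y rule: linorder_cases) auto
    then show ?thesis by (intro arg_cong[of _ _ length] filter_cong refl) auto
  qed
  finally have "(\<Sum>y\<leftarrow>rev w. length (filter (\<lambda>z. z < y) [x])) + length (filter (\<lambda>y. y < x) w) = length w"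
    using sum_length_filter_compl[of "\<lambda>y. y < x" w] by simp
  then have "2 * (inv_num (rev (x # w)) + inv_num (x # w)) = 2 * length w + length w * (length w - 1)"
    using Cons by (simp add: inv_num_append)
  also have "\<dots> = length (x # w) * (length (x # w) - 1)" by (cases w) auto
  finally show ?case .
qed simp

lemma part_compl:
  "even_part (compl N w) = compl N (even_part w)" "odd_part (compl N w) = compl N (odd_part w)"
  by (simp_all add: even_part_def odd_part_def compl_def nths_map)

lemma even_part_rev:
  assumes "even (length w)"
  shows "even_part (rev w) = rev (odd_part w)"
  using assms
proof (induction w rule: induct_list012)
  case (3 x y w)
  have "odd_part (x # y # w) = x # odd_part w" by (simp add: odd_part_def nths_Cons)
  moreover have "even_part (rev w @ [y, x]) = even_part (rev w) @ [x]"
    using 3 by (simp add: even_part_def nths_append nths_Cons)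
  ultimately show ?case using 3 by simp
qed (auto simp: even_part_def odd_part_def)

lemma length_parts:
  assumes "length w = 2 * n"
  shows "length (even_part w) = n" "length (odd_part w) = n"
proof -
  have "length (even_part w) = n \<and> length (odd_part w) = n" using assms
  proof (induction n arbitrary: w)
    case (Suc n)
    then have "length w = Suc (Suc (2 * n))" by simp
    then obtain x y w' where "w = x # y # w'" by (auto simp: length_Suc_conv)
    then show ?case using Suc by (simp add: even_part_def odd_part_def nths_Cons)
  qed (auto simp: even_part_def odd_part_def)
  then show "length (even_part w) = n" "length (odd_part w) = n" by auto
qed

text \<open>The reverse complement maps alternating words of even length to such words.  It preserves
  inversions and ascents, and it exchanges odd and even positions.\<close>

lemma inv_gf_star:
  assumes "star \<in> {odd_part, even_part}"
  shows "(\<Sum>w\<in>alt_lists {1..2 * n}. q ^ inv_num w * t ^ asc (star w)) = inv_gf q t {1..2 * n}"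
proof -
  let ?N = "2 * n"
  let ?r = "\<lambda>w. rev (compl ?N w)"
  have *: "?r (?r w) = w \<and> ?r w \<in> alt_lists {1..?N} \<and>
      inv_weight q t (?r w) = q ^ inv_num w * t ^ asc (odd_part w)" if "w \<in> alt_lists {1..?N}" for w
  proof (intro conjI)
    from that have w: "w \<in> permutations_of_set {1..?N}" "alternating (<) (>) w"
      by (auto simp: alt_lists_def)
    have s: "set w \<subseteq> {1..?N}" and d: "distinct w" and l: "length w = ?N"
      using alt_listsD(1-3)[OF that] by auto
    have cs: "set (compl ?N w) \<subseteq> {1..?N}" "distinct (compl ?N w)"
      using compl_permutation[OF w(1)] by (auto simp: permutations_of_set_def)
    have r: "compl ?N (rev v) = rev (compl ?N v)" for v by (simp add: compl_def rev_map)
    show "?r (?r w) = w" using compl_compl[OF s] by (simp add: r)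
    show "?r w \<in> alt_lists {1..?N}"
      using compl_permutation[OF w(1)] w(2) l s
      by (simp add: alt_lists_def permutations_of_set_def alternating_rev alternating_compl)
    have "inv_num (?r w) = inv_num w"
      using inv_num_rev[OF cs(2)] inv_num_compl[OF d s] by simp
    moreover have "asc (even_part (?r w)) = asc (odd_part w)"
    proof -
      have "set (odd_part w) \<subseteq> {1..?N}" using s by (auto simp: odd_part_def dest: in_set_nthsD)
      then show ?thesis
        using l by (simp add: even_part_rev part_compl asc_rev des_compl)
    qed
    ultimately show "inv_weight q t (?r w) = q ^ inv_num w * t ^ asc (odd_part w)"
      by (simp add: inv_weight_def)
  qed
  have "(\<Sum>w\<in>alt_lists {1..?N}. q ^ inv_num w * t ^ asc (odd_part w)) = inv_gf q t {1..?N}"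
    unfolding inv_gf_def
    by (rule sum.reindex_bij_witness[of _ ?r ?r]) (use * in blast)+
  then show ?thesis using assms by (auto simp: inv_gf_def inv_weight_def)
qed

lemma inv_sum_Alt:
  "inv_sum q Alt stat n = (\<Sum>w\<in>alt_lists {1..2 * n}. q powi (int (inv_num w) + stat w))"
  unfolding inv_sum_def Alt_def alt_lists_def by (rule sum_perm_word)

text \<open>Complementing the values turns the two kinds of alternating permutations into each other
  and replaces the inversions by the remaining ones of the \<open>n (2n - 1)\<close> pairs.\<close>

lemma inv_sum_Ralt:
  assumes "q \<noteq> 0"
  shows "inv_sum q Ralt stat n = (\<Sum>w\<in>alt_lists {1..2 * n}.
    q powi (2 * int n ^ 2 - int n - int (inv_num w) + stat (compl (2 * n) w)))"
proof -
  let ?N = "2 * n"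
  have "inv_sum q Ralt stat n = (\<Sum>w | w \<in> permutations_of_set {1..?N} \<and> alternating (>) (<) w.
      q powi (int (inv_num w) + stat w))"
    unfolding inv_sum_def Ralt_def by (rule sum_perm_word)
  also have "\<dots> = (\<Sum>w\<in>alt_lists {1..?N}.
      q powi (2 * int n ^ 2 - int n - int (inv_num w) + stat (compl ?N w)))"
  proof (rule sum.reindex_bij_witness[of _ "compl ?N" "compl ?N"])
    fix w assume "w \<in> {w \<in> permutations_of_set {1..?N}. alternating (>) (<) w}"
    then have w: "w \<in> permutations_of_set {1..?N}" "alternating (>) (<) w" by auto
    then have s: "set w \<subseteq> {1..?N}" "distinct w" "length w = ?N"
      by (auto simp: permutations_of_set_def dest: distinct_card)
    show c: "compl ?N (compl ?N w) = w" by (rule compl_compl[OF s(1)])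
    show "compl ?N w \<in> alt_lists {1..?N}"
      using compl_permutation[OF w(1)] w(2) alternating_compl[OF s(1)] by (simp add: alt_lists_def)
    have "int (2 * (inv_num (compl ?N w) + inv_num w)) = int (?N * (?N - 1))"
      by (simp only: inv_num_compl[OF s(2,1)] s(3))
    then have "int (inv_num w) = 2 * int n ^ 2 - int n - int (inv_num (compl ?N w))"
      by (cases n) (auto simp: power2_eq_square algebra_simps)
    then show "q powi (2 * int n ^ 2 - int n - int (inv_num (compl ?N w)) + stat (compl ?N (compl ?N w)))
        = q powi (int (inv_num w) + stat w)"
      by (simp add: c)
  next
    fix w assume w: "w \<in> alt_lists {1..?N}"
    then have s: "set w \<subseteq> {1..?N}" using alt_listsD by blast
    show "compl ?N (compl ?N w) = w" by (rule compl_compl[OF s(1)])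
    show "compl ?N w \<in> {w \<in> permutations_of_set {1..?N}. alternating (>) (<) w}"
      using compl_permutation[of w ?N] w alternating_compl[OF s] by (simp add: alt_lists_def)
  qed
  finally show ?thesis .
qed

section \<open>Coefficients of the reciprocal series\<close>

text \<open>The common value of all sums in the theorem: the coefficient of \<open>x\<^sup>2\<^sup>n\<close> in the
  reciprocal of the given denominator, written in the variable \<open>x\<^sup>2\<close>.\<close>

definition sec_coeff :: "real \<Rightarrow> int \<Rightarrow> int \<Rightarrow> nat \<Rightarrow> real" where
  "sec_coeff q C D n = inverse (Abs_fps (\<lambda>n.
    (-1) ^ n * q powi (C * int n ^ 2 + D * int n) / qpochhammer q q (2 * n))) $ n"

lemma inverse_Abs_fps_scale:
  fixes c :: "nat \<Rightarrow> real"
  assumes "c 0 \<noteq> 0"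
  shows "inverse (Abs_fps (\<lambda>n. a ^ n * c n)) $ n = a ^ n * inverse (Abs_fps c) $ n"
proof -
  have "Abs_fps (\<lambda>n. a ^ n * c n) = Abs_fps c oo (fps_const a * fps_X)"
    by (simp add: fps_eq_iff)
  then have "inverse (Abs_fps (\<lambda>n. a ^ n * c n)) = inverse (Abs_fps c) oo (fps_const a * fps_X)"
    using assms by (simp add: fps_inverse_compose)
  then show ?thesis by simp
qed

text \<open>This is the substitution of \<open>q\<^sup>j x\<close> for \<open>x\<close>, in the variable that
  stands for \<open>x\<^sup>2\<close>.\<close>

lemma sec_coeff_scale:
  assumes "0 < q"
  shows "sec_coeff q C (D + j) n = q powi (j * int n) * sec_coeff q C D n"
proof -
  have eq: "(-1) ^ n * q powi (C * int n ^ 2 + (D + j) * int n) / qpochhammer q q (2 * n) =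
      (q powi j) ^ n * ((-1) ^ n * q powi (C * int n ^ 2 + D * int n) / qpochhammer q q (2 * n))" for n
  proof -
    have "q powi (C * int n ^ 2 + (D + j) * int n) = q powi (C * int n ^ 2 + D * int n) * q powi (j * int n)"
      using assms by (simp add: power_int_add[symmetric] algebra_simps)
    then show ?thesis by (simp add: power_int_mult)
  qed
  show ?thesis
    unfolding sec_coeff_def eq by (subst inverse_Abs_fps_scale) (simp_all add: power_int_mult)
qed

lemma qpochhammer_reciprocal:
  assumes "0 < q"
  shows "qpochhammer (1 / q) (1 / q) (2 * n) = q powi (- (2 * int n ^ 2 + int n)) * qpochhammer q q (2 * n)"
proof (induction n)
  case (Suc n)
  have rec: "qpochhammer r r (2 * Suc n) = qpochhammer r r (2 * n) * ((1 - r ^ (2 * n + 1)) * (1 - r ^ (2 * n + 2)))"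
    for r using qpochhammer_Suc[of r "2 * n"] qpochhammer_Suc[of r "2 * n + 1"] by simp
  have flip: "1 - (1 / q) ^ k = - (q powi (- int k)) * (1 - q ^ k)" for k
    using assms by (simp add: power_int_minus power_one_over divide_simps)
  have "q powi (- (2 * int (Suc n) ^ 2 + int (Suc n))) =
      q powi (- (2 * int n ^ 2 + int n)) * (q powi (- int (2 * n + 1)) * q powi (- int (2 * n + 2)))"
    using assms by (simp add: power_int_add[symmetric] power2_eq_square algebra_simps)
  then show ?case unfolding rec Suc flip by (simp add: algebra_simps)
qed simp

text \<open>The change of exponents comes from extracting the powers of \<open>q\<close> from the
  \<open>2n\<close> factors of the \<open>q\<close>-factorial; their number is even, so no sign appears.\<close>

lemma sec_coeff_reciprocal:
  assumes "0 < q"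
  shows "sec_coeff (1 / q) C D n = sec_coeff q (2 - C) (1 - D) n"
proof -
  have "(1 / q) powi (C * int n ^ 2 + D * int n) / qpochhammer (1 / q) (1 / q) (2 * n) =
      q powi ((2 - C) * int n ^ 2 + (1 - D) * int n) / qpochhammer q q (2 * n)" for n
  proof -
    have "(1 / q) powi (C * int n ^ 2 + D * int n) = q powi (- (C * int n ^ 2 + D * int n))"
      by (simp only: power_int_minus power_int_inverse inverse_eq_divide[symmetric])
    moreover have "q powi ((2 - C) * int n ^ 2 + (1 - D) * int n) =
        q powi (- (C * int n ^ 2 + D * int n)) / q powi (- (2 * int n ^ 2 + int n))"
      using assms by (simp add: power_int_diff[symmetric] algebra_simps)
    ultimately show ?thesis unfolding qpochhammer_reciprocal[OF assms] by simp
  qed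
  then show ?thesis by (simp add: sec_coeff_def times_divide_eq_right[symmetric] del: times_divide_eq_right)
qed

text \<open>For \<open>t = 1\<close> and for \<open>t = 1/q\<close> the pair of difference equations has an
  explicit solution.  Its cosine is the denominator, and its sine is then forced by the second
  equation.\<close>

theorem inv_gf_eq_sec_coeff:
  assumes q: "0 < q" "q \<noteq> 1"
  shows "inv_gf q 1 {1..2 * n} / qpochhammer q q (2 * n) = sec_coeff q 0 0 n"
    and "inv_gf q (1 / q) {1..2 * n} / qpochhammer q q (2 * n) = sec_coeff q 1 (- 1) n"
proof -
  note Q0 = qpochhammer_nonzero[OF q]
  have q1: "1 - q \<noteq> 0" using q by simp
  have pos: "1 - q ^ Suc k \<noteq> 0" for k using Q0[of "Suc k"] by (auto simp: qpochhammer_Suc)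
  have gf: "inv_gf q t {1..2 * n} / qpochhammer q q (2 * n) = inverse (Abs_fps c) $ n"
    if c0: "c 0 = 1"
      and H1: "\<And>n. (q ^ (2 * n + 2) - 1) * c (Suc n) =
        t * (c n / (1 - q ^ (2 * n + 1))) + (1 - t) / (1 - q) * c n" for t c
  proof -
    have H2: "(1 - q ^ (2 * n + 1)) * (c n / (1 - q ^ (2 * n + 1))) = c n" for n
      using pos[of "2 * n"] by simp
    note R = secant_tangent_recurrence[OF q c0 H1 H2]
    show ?thesis
      using inv_gf_eq[OF q R(1,2,4), of "{1..2 * n}"] R(3)[of n] Q0[of "2 * n"] by simp
  qed
  have Q2: "qpochhammer q q (2 * Suc n) = qpochhammer q q (2 * n) * ((1 - q ^ (2 * n + 1)) * (1 - q ^ (2 * n + 2)))"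
    for n using qpochhammer_Suc[of q "2 * n"] qpochhammer_Suc[of q "2 * n + 1"] by simp
  have step: "(q ^ (2 * n + 2) - 1) * ((-1) ^ Suc n * x / qpochhammer q q (2 * Suc n)) =
      (-1) ^ n * x / (qpochhammer q q (2 * n) * (1 - q ^ (2 * n + 1)))" for n x
    using pos[of "2 * n"] pos[of "2 * n + 1"] Q0[of "2 * n"] unfolding Q2
    by (simp add: divide_simps) (simp add: algebra_simps)
  show "inv_gf q 1 {1..2 * n} / qpochhammer q q (2 * n) = sec_coeff q 0 0 n"
    unfolding sec_coeff_def
    by (rule gf) (use step[of _ 1] in \<open>simp_all add: mult.commute\<close>)
  show "inv_gf q (1 / q) {1..2 * n} / qpochhammer q q (2 * n) = sec_coeff q 1 (- 1) n"
    unfolding sec_coeff_def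
  proof (rule gf)
    fix n
    let ?x = "q powi (int n ^ 2 - int n)"
    have x: "q powi (1 * int (Suc n) ^ 2 + - 1 * int (Suc n)) = ?x * q ^ (2 * n)"
    proof -
      have "q powi (1 * int (Suc n) ^ 2 + - 1 * int (Suc n)) = ?x * q powi (int (2 * n))"
        using q by (simp add: power_int_add[symmetric] power2_eq_square algebra_simps)
      then show ?thesis by (simp only: power_int_of_nat)
    qed
    have t: "1 / q / (1 - q ^ (2 * n + 1)) + (1 - 1 / q) / (1 - q) = q ^ (2 * n) / (1 - q ^ (2 * n + 1))"
    proof -
      have "(1 - 1 / q) / (1 - q) = - 1 / q" using q q1 by (simp add: divide_simps)
      then show ?thesis using q pos[of "2 * n"] by (simp add: divide_simps) (simp add: algebra_simps)
    qed
    have distribute: "x * (1 / q / y + z) = 1 / q * (x / y) + z * x" for x y z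
      by (simp add: distrib_left)
    let ?c = "(-1) ^ n * q powi (1 * int n ^ 2 + - 1 * int n) / qpochhammer q q (2 * n)"
    have "(q ^ (2 * n + 2) - 1) * ((-1) ^ Suc n * q powi (1 * int (Suc n) ^ 2 + - 1 * int (Suc n)) / qpochhammer q q (2 * Suc n))
       = ?c * (q ^ (2 * n) / (1 - q ^ (2 * n + 1)))"
      unfolding x step by simp
    also have "\<dots> = 1 / q * (?c / (1 - q ^ (2 * n + 1))) + (1 - 1 / q) / (1 - q) * ?c"
      unfolding t[symmetric] by (rule distribute)
    finally show "(q ^ (2 * n + 2) - 1) * ((-1) ^ Suc n * q powi (1 * int (Suc n) ^ 2 + - 1 * int (Suc n)) / qpochhammer q q (2 * Suc n))
       = 1 / q * (?c / (1 - q ^ (2 * n + 1))) + (1 - 1 / q) / (1 - q) * ?c" .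
  qed simp
qed

text \<open>Decreasing patterns are chains directly; increasing patterns become chains after
  reversal.\<close>

theorem alt_words_weight_eq_sec_coeff:
  assumes q: "0 < q" "q < 1"
    and chain: "(\<forall>x y. \<alpha> x y \<longleftrightarrow> y + a \<le> x) \<and> (\<forall>x y. \<not> \<beta> x y \<longleftrightarrow> y + b \<le> x) \<or>
      (\<forall>x y. \<alpha> x y \<longleftrightarrow> x + a \<le> y) \<and> (\<forall>x y. \<not> \<beta> x y \<longleftrightarrow> x + b \<le> y)"
  shows "word_weight q (alt_words \<alpha> \<beta> (2 * n)) = sec_coeff q (int (a + b)) (- int b) n"
proof -
  define f where "f n = word_weight q (alt_words \<alpha> \<beta> (2 * n))" for n
  define g where "g n = (-1) ^ n * q powi (int (a + b) * int n ^ 2 + - int b * int n) / qpochhammer q q (2 * n)" for n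
  have weight: "word_weight q (alt_words \<alpha> (\<lambda>x y. \<not> \<beta> x y) (2 * k)) =
      word_weight q (alt_words (\<lambda>x y. y + a \<le> x) (\<lambda>x y. y + b \<le> x) (2 * k))" for k
    using chain
  proof
    assume "(\<forall>x y. \<alpha> x y \<longleftrightarrow> y + a \<le> x) \<and> (\<forall>x y. \<not> \<beta> x y \<longleftrightarrow> y + b \<le> x)"
    then have "\<alpha> = (\<lambda>x y. y + a \<le> x)" "(\<lambda>x y. \<not> \<beta> x y) = (\<lambda>x y. y + b \<le> x)" by (auto simp: fun_eq_iff)
    then show ?thesis by (simp only:)
  next
    assume "(\<forall>x y. \<alpha> x y \<longleftrightarrow> x + a \<le> y) \<and> (\<forall>x y. \<not> \<beta> x y \<longleftrightarrow> x + b \<le> y)"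
    then have "\<alpha> = (\<lambda>x y. x + a \<le> y)" "(\<lambda>x y. \<not> \<beta> x y) = (\<lambda>x y. x + b \<le> y)" by (auto simp: fun_eq_iff)
    then show ?thesis using alt_words_rev[of "2 * k" q "\<lambda>x y. x + a \<le> y" "\<lambda>x y. x + b \<le> y"] by simp
  qed
  have g: "g k = (-1) ^ k * word_weight q (alt_words \<alpha> (\<lambda>x y. \<not> \<beta> x y) (2 * k))" for k
  proof -
    have "int (k * k * a + k * (k - 1) * b) = int (a + b) * int k ^ 2 + - int b * int k"
      by (cases k) (auto simp: power2_eq_square algebra_simps)
    then have "q powi (int (a + b) * int k ^ 2 + - int b * int k) = q ^ (k * k * a + k * (k - 1) * b)"
      by (metis power_int_of_nat)
    then show ?thesis unfolding g_def weight alt_words_chain_weight[OF q] by simp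
  qed
  have "Abs_fps g * Abs_fps f = 1"
  proof (rule fps_ext)
    fix n
    show "(Abs_fps g * Abs_fps f) $ n = 1 $ n"
    proof (cases "n = 0")
      case True
      then show ?thesis by (simp add: g_def f_def alt_words_0 word_weight_def)
    next
      case False
      have "(Abs_fps g * Abs_fps f) $ n = (\<Sum>k\<le>n. g k * f (n - k))"
        by (simp add: fps_mult_nth atMost_atLeast0)
      also have "\<dots> = 0"
        unfolding g f_def using alt_words_weight_convolution[OF q, of n \<alpha> \<beta>] False by simp
      finally show ?thesis using False by simp
    qed
  qed
  then have "inverse (Abs_fps g) = Abs_fps f" by (rule fps_inverse_unique)
  then have "inverse (Abs_fps g) $ n = word_weight q (alt_words \<alpha> \<beta> (2 * n))" by (simp add: f_def)
  then show ?thesis unfolding sec_coeff_def g_def[abs_def] by (simp only:)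
qed

lemma even_fps_eq_inverse:
  assumes "\<And>n. f n = sec_coeff q C D n"
  shows "even_fps f = inverse (even_fps (\<lambda>n.
    (-1) ^ n * q powi (C * int n ^ 2 + D * int n) / qpochhammer q q (2 * n)))"
proof -
  have "f = sec_coeff q C D" using assms by auto
  then show ?thesis by (subst even_fps_inverse) (simp_all add: sec_coeff_def[abs_def])
qed

section \<open>Major index and inversion sums in the six cases\<close>

lemma eta_less: "Suc i < 2 * n \<Longrightarrow> eta n (Suc i) < eta n (Suc (Suc i)) \<longleftrightarrow> odd i"
  by (auto simp: eta_apply elim!: oddE evenE)

lemma kappa_less: "Suc i < 2 * n \<Longrightarrow> kappa n (Suc i) < kappa n (Suc (Suc i)) \<longleftrightarrow> even i"
  by (auto simp: kappa_apply elim!: oddE evenE)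

lemma inj_eta: "inj_on (eta n) S"
proof (rule inj_on_inverseI)
  show "eta n (eta n k) = k" for k by (auto simp: eta_apply elim!: oddE evenE) (presburger+)?
qed

lemma inj_kappa: "inj_on (kappa n) S"
proof (rule inj_on_inverseI)
  show "kappa n (kappa n k) = k" for k by (auto simp: kappa_apply elim!: oddE evenE) (presburger+)?
qed

text \<open>The third sum is \<open>q\<^sup>n\<close> times the second, because both subwords have length
  \<open>n\<close>.\<close>

lemma inv_sum_Alt_eq:
  assumes q: "0 < q" "q \<noteq> 1" and star: "star \<in> {odd_part, even_part}"
  shows "inv_sum q Alt (\<lambda>w. 0) n / qpochhammer q q (2 * n) = sec_coeff q 0 0 n"
    and "inv_sum q Alt (\<lambda>w. - int (asc (star w))) n / qpochhammer q q (2 * n) = sec_coeff q 1 (- 1) n"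
    and "inv_sum q Alt (\<lambda>w. int (nasc (star w))) n / qpochhammer q q (2 * n) = sec_coeff q 1 0 n"
proof -
  have weight: "q powi (int a + - int b) = q ^ a * (1 / q) ^ b" for a b
    using q by (simp add: power_int_diff power_one_over divide_simps)
  have shift: "q powi (int n + e) = q ^ n * q powi e" for e
    using q by (simp add: power_int_add)
  show "inv_sum q Alt (\<lambda>w. 0) n / qpochhammer q q (2 * n) = sec_coeff q 0 0 n"
    using inv_gf_star[OF star, where t = 1] inv_gf_eq_sec_coeff(1)[OF q] by (simp add: inv_sum_Alt)
  have A: "inv_sum q Alt (\<lambda>w. - int (asc (star w))) n = inv_gf q (1 / q) {1..2 * n}"
    unfolding inv_sum_Alt weight by (rule inv_gf_star[OF star])
  then show *: "inv_sum q Alt (\<lambda>w. - int (asc (star w))) n / qpochhammer q q (2 * n) = sec_coeff q 1 (- 1) n"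
    using inv_gf_eq_sec_coeff(2)[OF q] by simp
  have "inv_sum q Alt (\<lambda>w. int (nasc (star w))) n = q ^ n * inv_sum q Alt (\<lambda>w. - int (asc (star w))) n"
    unfolding inv_sum_Alt sum_distrib_left
  proof (rule sum.cong[OF refl])
    fix w assume "w \<in> alt_lists {1..2 * n}"
    then have len: "length (star w) = n" using alt_listsD(3)[of w] length_parts[of w n] star by auto
    have "asc (star w) \<le> card {1..<length (star w)}" unfolding asc_def by (rule card_mono) auto
    with len have e: "int (inv_num w) + int (nasc (star w)) = int n + (int (inv_num w) + - int (asc (star w)))"
      by (simp add: nasc_def of_nat_diff)
    show "q powi (int (inv_num w) + int (nasc (star w))) =
        q ^ n * q powi (int (inv_num w) + - int (asc (star w)))"
      unfolding e by (rule shift)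
  qed
  then show "inv_sum q Alt (\<lambda>w. int (nasc (star w))) n / qpochhammer q q (2 * n) = sec_coeff q 1 0 n"
    using * sec_coeff_scale[of q 1 "- 1" 1 n] q
    by (simp add: times_divide_eq_right[symmetric] del: times_divide_eq_right)
qed

text \<open>All three sums become sums over \<open>Alt\<close> by complementation, with \<open>q\<close> replaced
  by \<open>1/q\<close>.  Since inversions are then counted with a negative sign and ascents with a
  positive one, the weight of an ascent is \<open>q\<close>, which is the reciprocal of the new base as the
  second part of \<open>inv_gf_eq_sec_coeff\<close> requires.\<close>

lemma inv_sum_Ralt_eq:
  assumes q: "0 < q" "q \<noteq> 1" and star: "star \<in> {odd_part, even_part}"
  shows "inv_sum q Ralt (\<lambda>w. 0) n / qpochhammer q q (2 * n) = sec_coeff q 2 (- 1) n"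
    and "inv_sum q Ralt (\<lambda>w. - int (ndes (star w))) n / qpochhammer q q (2 * n) = sec_coeff q 1 (- 1) n"
    and "inv_sum q Ralt (\<lambda>w. int (des (star w))) n / qpochhammer q q (2 * n) = sec_coeff q 1 0 n"
proof -
  have q': "0 < 1 / q" "1 / q \<noteq> 1" "q \<noteq> 0" using q by auto
  note Q0 = qpochhammer_nonzero[OF q]
  have weight: "q powi (e - int a + int b) = q powi e * ((1 / q) ^ a * q ^ b)" for e a b
    using q by (simp add: power_int_diff power_int_add power_one_over divide_simps)
  have complement: "inv_sum q Ralt stat n / qpochhammer q q (2 * n) =
      q powi (e - 2 * int n ^ 2 - int n) * (inv_gf (1 / q) t {1..2 * n} / qpochhammer (1 / q) (1 / q) (2 * n))"
    if "\<And>w. w \<in> alt_lists {1..2 * n} \<Longrightarrow>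
      q powi (2 * int n ^ 2 - int n - int (inv_num w) + stat (compl (2 * n) w)) =
        q powi e * ((1 / q) ^ inv_num w * t ^ asc (star w))" for stat e t
  proof -
    have "inv_sum q Ralt stat n = q powi e * inv_gf (1 / q) t {1..2 * n}"
      unfolding inv_sum_Ralt[OF q'(3)] inv_gf_star[OF star, symmetric] sum_distrib_left
      by (rule sum.cong[OF refl that])
    moreover have "q powi (e - 2 * int n ^ 2 - int n) = q powi e * q powi (- (2 * int n ^ 2 + int n))"
      using q by (simp add: power_int_add[symmetric] algebra_simps)
    ultimately show ?thesis
      unfolding qpochhammer_reciprocal[OF q(1)] using q by simp
  qed
  have parts: "des (star (compl (2 * n) w)) = asc (star w)" "length (star (compl (2 * n) w)) = n"
    if "w \<in> alt_lists {1..2 * n}" for w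
  proof -
    have s: "set (odd_part w) \<subseteq> {1..2 * n}" "set (even_part w) \<subseteq> {1..2 * n}"
      using alt_listsD(1)[OF that] by (auto simp: odd_part_def even_part_def dest: in_set_nthsD)
    show "des (star (compl (2 * n) w)) = asc (star w)"
      using star s by (auto simp: part_compl des_compl)
    show "length (star (compl (2 * n) w)) = n"
      using star length_parts[of "compl (2 * n) w" n] alt_listsD(3)[OF that] by auto
  qed
  have "inv_sum q Ralt (\<lambda>w. 0) n / qpochhammer q q (2 * n) =
      q powi ((2 * int n ^ 2 - int n) - 2 * int n ^ 2 - int n) *
        (inv_gf (1 / q) 1 {1..2 * n} / qpochhammer (1 / q) (1 / q) (2 * n))"
    by (rule complement) (use weight[of _ _ 0] in simp)
  also have "\<dots> = q powi (- 2 * int n) * sec_coeff q 2 1 n"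
    using inv_gf_eq_sec_coeff(1)[OF q'(1,2), of n] sec_coeff_reciprocal[OF q(1), of 0 0 n] by simp
  also have "\<dots> = sec_coeff q 2 (- 1) n"
    using sec_coeff_scale[OF q(1), of 2 1 "- 2" n] by simp
  finally show "inv_sum q Ralt (\<lambda>w. 0) n / qpochhammer q q (2 * n) = sec_coeff q 2 (- 1) n" .
  have ndes: "- int (ndes (star (compl (2 * n) w))) = int (asc (star w)) - int n"
    if "w \<in> alt_lists {1..2 * n}" for w
  proof -
    let ?v = "star (compl (2 * n) w)"
    have "des ?v \<le> card {1..<length ?v}" unfolding des_def by (rule card_mono) auto
    then have "des ?v \<le> n" using parts(2)[OF that] by simp
    then show ?thesis using parts[OF that] by (simp add: ndes_def of_nat_diff)
  qed
  have inv_recip: "inv_gf (1 / q) q {1..2 * n} / qpochhammer (1 / q) (1 / q) (2 * n) = sec_coeff q 1 2 n"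
    using inv_gf_eq_sec_coeff(2)[OF q'(1,2), of n] sec_coeff_reciprocal[OF q(1), of 1 "- 1" n] by simp
  have "inv_sum q Ralt (\<lambda>w. - int (ndes (star w))) n / qpochhammer q q (2 * n) =
      q powi ((2 * int n ^ 2 - 2 * int n) - 2 * int n ^ 2 - int n) *
        (inv_gf (1 / q) q {1..2 * n} / qpochhammer (1 / q) (1 / q) (2 * n))"
  proof (rule complement)
    fix w assume w: "w \<in> alt_lists {1..2 * n}"
    show "q powi (2 * int n ^ 2 - int n - int (inv_num w) + - int (ndes (star (compl (2 * n) w)))) =
      q powi (2 * int n ^ 2 - 2 * int n) * ((1 / q) ^ inv_num w * q ^ asc (star w))"
      unfolding ndes[OF w] weight[symmetric] by (simp add: algebra_simps)
  qed
  also have "\<dots> = sec_coeff q 1 (- 1) n"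
    unfolding inv_recip using sec_coeff_scale[OF q(1), of 1 2 "- 3" n] by simp
  finally show "inv_sum q Ralt (\<lambda>w. - int (ndes (star w))) n / qpochhammer q q (2 * n) = sec_coeff q 1 (- 1) n" .
  have "inv_sum q Ralt (\<lambda>w. int (des (star w))) n / qpochhammer q q (2 * n) =
      q powi ((2 * int n ^ 2 - int n) - 2 * int n ^ 2 - int n) *
        (inv_gf (1 / q) q {1..2 * n} / qpochhammer (1 / q) (1 / q) (2 * n))"
    by (rule complement) (simp only: parts weight)
  also have "\<dots> = sec_coeff q 1 0 n"
    unfolding inv_recip using sec_coeff_scale[OF q(1), of 1 2 "- 2" n] by simp
  finally show "inv_sum q Ralt (\<lambda>w. int (des (star w))) n / qpochhammer q q (2 * n) = sec_coeff q 1 0 n" .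
qed

lemma alt_words_weight_eq_maj_sum:
  assumes q: "0 < q" "q < 1" and inj: "\<And>n. inj_on (\<sigma> n) {1..2 * n}"
    and rel: "\<And>i x y. Suc i < 2 * n \<Longrightarrow> (if even i then \<alpha> else \<beta>) x y \<longleftrightarrow>
      ((even i = up) = (y < x \<or> x = y \<and> \<sigma> n (Suc i) < \<sigma> n (Suc (Suc i))))"
  shows "word_weight q (alt_words \<alpha> \<beta> (2 * n)) = maj_sum q (alt_perms up) \<sigma> n / qpochhammer q q (2 * n)"
  unfolding maj_sum_def by (rule alt_words_weight_eq_maj[OF q inj rel])

text \<open>It suffices to compare each expression with the weight of alternating words or with the
  coefficients of the reciprocal series.\<close>

lemma equalities_from_words:
  fixes q :: real
  assumes q: "0 < q" "q < 1"
    and f: "\<And>n. f n = tau \<alpha> \<beta> (2 * n) q / (1 - q) ^ (2 * n)"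
    and shift: "\<And>x y. \<alpha> (Suc x) (Suc y) = \<alpha> x y" "\<And>x y. \<beta> (Suc x) (Suc y) = \<beta> x y"
    and fill: "\<And>n. ((\<lambda>\<pi>. q ^ (\<Sum>c\<in>skew (shape (n + 2)) (delta n). \<pi> c)) has_sum
      word_weight q (alt_words \<alpha> \<beta> (2 * n))) (TAB (skew (shape (n + 2)) (delta n)))"
    and maj: "\<And>n. word_weight q (alt_words \<alpha> \<beta> (2 * n)) = M n / qpochhammer q q (2 * n)"
    and words: "\<And>n. word_weight q (alt_words \<alpha> \<beta> (2 * n)) = sec_coeff q C D n"
    and inv: "\<And>star n. star \<in> {odd_part, even_part} \<Longrightarrow> I star n / qpochhammer q q (2 * n) = sec_coeff q C D n"
  shows "(\<forall>n.
      ((\<lambda>\<pi>. q ^ (\<Sum>c\<in>skew (shape (n + 2)) (delta n). \<pi> c)) has_sum f n)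
        (TAB (skew (shape (n + 2)) (delta n))) \<and>
      f n = M n / qpochhammer q q (2 * n) \<and>
      f n = I odd_part n / qpochhammer q q (2 * n) \<and>
      f n = I even_part n / qpochhammer q q (2 * n)) \<and>
    even_fps f =
      inverse (even_fps (\<lambda>n. (-1) ^ n * q powi (C * int n ^ 2 + D * int n) / qpochhammer q q (2 * n)))"
proof -
  have f_words: "f n = word_weight q (alt_words \<alpha> \<beta> (2 * n))" for n
  proof -
    have "tau \<alpha> \<beta> (2 * n) q = (1 - q) ^ (2 * n) * word_weight q (alt_words \<alpha> \<beta> (2 * n))"
      by (rule tau_eq_word_weight[OF q]) (rule shift)+
    then show ?thesis using q by (simp add: f)
  qed
  show ?thesis
  proof (intro conjI allI)
    show "((\<lambda>\<pi>. q ^ (\<Sum>c\<in>skew (shape (n + 2)) (delta n). \<pi> c)) has_sum f n)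
        (TAB (skew (shape (n + 2)) (delta n)))" for n
      unfolding f_words by (rule fill)
    show "f n = M n / qpochhammer q q (2 * n)" for n
      unfolding f_words by (rule maj)
    show "f n = I odd_part n / qpochhammer q q (2 * n)" "f n = I even_part n / qpochhammer q q (2 * n)" for n
      using inv[of odd_part n] inv[of even_part n] by (simp_all add: f_words words)
    show "even_fps f =
        inverse (even_fps (\<lambda>n. (-1) ^ n * q powi (C * int n ^ 2 + D * int n) / qpochhammer q q (2 * n)))"
      by (rule even_fps_eq_inverse) (simp add: f_words words)
  qed
qed

theorem theorem4p3:
  fixes q :: real
    and \<alpha> \<beta> :: "nat \<Rightarrow> nat \<Rightarrow> bool"
    and TAB :: "(nat \<times> nat) set \<Rightarrow> (nat \<times> nat \<Rightarrow> nat) set"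
    and shape :: "nat \<Rightarrow> nat list"
    and M :: "nat \<Rightarrow> real"
    and I :: "(nat list \<Rightarrow> nat list) \<Rightarrow> nat \<Rightarrow> real"
    and C D :: int
    and f :: "nat \<Rightarrow> real"
  assumes "0 < q" and "q < 1"
    and "(\<alpha>, \<beta>, TAB, shape, M, I, C, D) \<in>
      {((\<ge>), (<), SSYT, delta01, maj_sum q Alt (\<lambda>n. id),
          (\<lambda>star. inv_sum q Alt (\<lambda>w. 0)), 0, 0),
       ((\<ge>), (\<le>), RPP, delta01, maj_sum q Alt kappa,
          (\<lambda>star. inv_sum q Alt (\<lambda>w. - int (asc (star w)))), 1, -1),
       ((>), (<), ST, delta01, maj_sum q Alt eta,
          (\<lambda>star. inv_sum q Alt (\<lambda>w. int (nasc (star w)))), 1, 0),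
       ((<), (\<ge>), SSYT, delta10, maj_sum q Ralt (\<lambda>n. id),
          (\<lambda>star. inv_sum q Ralt (\<lambda>w. 0)), 2, -1),
       ((\<le>), (\<ge>), RPP, delta10, maj_sum q Ralt eta,
          (\<lambda>star. inv_sum q Ralt (\<lambda>w. - int (ndes (star w)))), 1, -1),
       ((<), (>), ST, delta10, maj_sum q Ralt kappa,
          (\<lambda>star. inv_sum q Ralt (\<lambda>w. int (des (star w)))), 1, 0)}"
    and "\<And>n. f n = tau \<alpha> \<beta> (2 * n) q / (1 - q) ^ (2 * n)"
  shows "(\<forall>n.
      ((\<lambda>\<pi>. q ^ (\<Sum>c\<in>skew (shape (n + 2)) (delta n). \<pi> c)) has_sum f n)
        (TAB (skew (shape (n + 2)) (delta n))) \<and>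
      f n = M n / qpochhammer q q (2 * n) \<and>
      f n = I odd_part n / qpochhammer q q (2 * n) \<and>
      f n = I even_part n / qpochhammer q q (2 * n)) \<and>
    even_fps f =
      inverse (even_fps (\<lambda>n. (-1) ^ n * q powi (C * int n ^ 2 + D * int n) / qpochhammer q q (2 * n)))"
proof -
  note q = assms(1,2) and f = assms(4)
  have q1: "0 < q" "q \<noteq> 1" using q by auto
  note words = alt_words_weight_eq_sec_coeff[OF q]
  note maj_Alt = alt_words_weight_eq_maj_sum[OF q, where up = True, folded Alt_eq_alt_perms]
    and maj_Ralt = alt_words_weight_eq_maj_sum[OF q, where up = False, folded Ralt_eq_alt_perms]
  from assms(3) show ?thesis
  proof (elim insertE emptyE, goal_cases)
    case 1
    then have e: "\<alpha> = (\<ge>)" "\<beta> = (<)" "TAB = SSYT" "shape = delta01" "M = maj_sum q Alt (\<lambda>n. id)"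
      "I = (\<lambda>star. inv_sum q Alt (\<lambda>w. 0))" "C = 0" "D = 0" by simp_all
    show ?case
    proof (rule equalities_from_words[OF q f], unfold e SSYT_def)
      show "word_weight q (alt_words (\<ge>) (<) (2 * n)) = maj_sum q Alt (\<lambda>n. id) n / qpochhammer q q (2 * n)" for n
        by (rule maj_Alt) (auto)
      show "word_weight q (alt_words (\<ge>) (<) (2 * n)) = sec_coeff q 0 (0) n" for n
        using words[of "(\<ge>)" 0 "(<)" 0 n] by (simp add: not_le not_less Suc_le_eq)
    qed (rule fillings_delta01[OF q] | (rule inv_sum_Alt_eq[OF q1], assumption) | simp)+
  next
    case 2
    then have e: "\<alpha> = (\<ge>)" "\<beta> = (\<le>)" "TAB = RPP" "shape = delta01" "M = maj_sum q Alt kappa"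
      "I = (\<lambda>star. inv_sum q Alt (\<lambda>w. - int (asc (star w))))" "C = 1" "D = -1" by simp_all
    show ?case
    proof (rule equalities_from_words[OF q f], unfold e RPP_def)
      show "word_weight q (alt_words (\<ge>) (\<le>) (2 * n)) = maj_sum q Alt kappa n / qpochhammer q q (2 * n)" for n
        by (rule maj_Alt) (auto simp: inj_kappa kappa_less)
      show "word_weight q (alt_words (\<ge>) (\<le>) (2 * n)) = sec_coeff q 1 (- 1) n" for n
        using words[of "(\<ge>)" 0 "(\<le>)" 1 n] by (simp add: not_le not_less Suc_le_eq)
    qed (rule fillings_delta01[OF q] | (rule inv_sum_Alt_eq[OF q1], assumption) | simp)+
  next
    case 3
    then have e: "\<alpha> = (>)" "\<beta> = (<)" "TAB = ST" "shape = delta01" "M = maj_sum q Alt eta"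
      "I = (\<lambda>star. inv_sum q Alt (\<lambda>w. int (nasc (star w))))" "C = 1" "D = 0" by simp_all
    show ?case
    proof (rule equalities_from_words[OF q f], unfold e ST_def)
      show "word_weight q (alt_words (>) (<) (2 * n)) = maj_sum q Alt eta n / qpochhammer q q (2 * n)" for n
        by (rule maj_Alt) (auto simp: inj_eta eta_less)
      show "word_weight q (alt_words (>) (<) (2 * n)) = sec_coeff q 1 (0) n" for n
        using words[of "(>)" 1 "(<)" 0 n] by (simp add: not_le not_less Suc_le_eq)
    qed (rule fillings_delta01[OF q] | (rule inv_sum_Alt_eq[OF q1], assumption) | simp)+
  next
    case 4
    then have e: "\<alpha> = (<)" "\<beta> = (\<ge>)" "TAB = SSYT" "shape = delta10" "M = maj_sum q Ralt (\<lambda>n. id)"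
      "I = (\<lambda>star. inv_sum q Ralt (\<lambda>w. 0))" "C = 2" "D = -1" by simp_all
    show ?case
    proof (rule equalities_from_words[OF q f], unfold e SSYT_def)
      show "word_weight q (alt_words (<) (\<ge>) (2 * n)) = maj_sum q Ralt (\<lambda>n. id) n / qpochhammer q q (2 * n)" for n
        by (rule maj_Ralt) (auto)
      show "word_weight q (alt_words (<) (\<ge>) (2 * n)) = sec_coeff q 2 (- 1) n" for n
        using words[of "(<)" 1 "(\<ge>)" 1 n] by (simp add: not_le not_less Suc_le_eq)
    qed (rule fillings_delta10[OF q] | (rule inv_sum_Ralt_eq[OF q1], assumption) | simp)+
  next
    case 5
    then have e: "\<alpha> = (\<le>)" "\<beta> = (\<ge>)" "TAB = RPP" "shape = delta10" "M = maj_sum q Ralt eta"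
      "I = (\<lambda>star. inv_sum q Ralt (\<lambda>w. - int (ndes (star w))))" "C = 1" "D = -1" by simp_all
    show ?case
    proof (rule equalities_from_words[OF q f], unfold e RPP_def)
      show "word_weight q (alt_words (\<le>) (\<ge>) (2 * n)) = maj_sum q Ralt eta n / qpochhammer q q (2 * n)" for n
        by (rule maj_Ralt) (auto simp: inj_eta eta_less)
      show "word_weight q (alt_words (\<le>) (\<ge>) (2 * n)) = sec_coeff q 1 (- 1) n" for n
        using words[of "(\<le>)" 0 "(\<ge>)" 1 n] by (simp add: not_le not_less Suc_le_eq)
    qed (rule fillings_delta10[OF q] | (rule inv_sum_Ralt_eq[OF q1], assumption) | simp)+
  next
    case 6
    then have e: "\<alpha> = (<)" "\<beta> = (>)" "TAB = ST" "shape = delta10" "M = maj_sum q Ralt kappa"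
      "I = (\<lambda>star. inv_sum q Ralt (\<lambda>w. int (des (star w))))" "C = 1" "D = 0" by simp_all
    show ?case
    proof (rule equalities_from_words[OF q f], unfold e ST_def)
      show "word_weight q (alt_words (<) (>) (2 * n)) = maj_sum q Ralt kappa n / qpochhammer q q (2 * n)" for n
        by (rule maj_Ralt) (auto simp: inj_kappa kappa_less)
      show "word_weight q (alt_words (<) (>) (2 * n)) = sec_coeff q 1 (0) n" for n
        using words[of "(<)" 1 "(>)" 0 n] by (simp add: not_le not_less Suc_le_eq)
    qed (rule fillings_delta10[OF q] | (rule inv_sum_Ralt_eq[OF q1], assumption) | simp)+
  qed
qed

end
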